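(* Let $(W,S)$ be a Coxeter system of type $A_n$, $n\ge1$. As a $\mathbb{Q}$-algebra, $\mathfrak{E}(W)=\mathbb{Q}[x_{n-1}]$ is isomorphic to $\mathbb{Q}[x]/(x^{\underline{n+1}}-x^{\underline{n}})$. Its $\mathbb{Q}$-bases $\{x_0,x_1,\dots,x_n\}$ and $\{x_{n-1}^0,\dots,x_{n-1}^n\}$ are related by the base change formulas $$x_{n-k}=\sum_{m=0}^k(-1)^{k-m}\genfrac{[}{]}{0pt}{}{k}{m}\,x_{n-1}^m\quad\text{and}\quad x_{n-1}^k=\sum_{m=0}^k\genfrac{\{}{\}}{0pt}{}{k}{m}\,x_{n-m},$$ for $0\le k\le n$.
   Context: For a finite Coxeter system $(W,S)$ with length function $\ell$ and $J\subseteq S$, let $X_J=\{w\in W: \ell(ws)>\ell(w)\text{ for all } s\in J\}$ and $x_J=\sum_{w\in X_J} w$ in the group algebra $\mathbb{Q}W$. For type $A_n$ label $S=\{s_1,\dots,s_n\}$ so that $s_is_{i+1}$ has order $3$ for $1\le i\le n-1$ and all other pairs of distinct generators commute. For $0\le j\le n$ put $x_j=x_{\{s_1,\dots,s_j\}}$ (so $x_n=1$). $\mathfrak{E}(W)=\mathbb{Q}[x_{n-1}]$ is the unital subalgebra of $\mathbb{Q}W$ generated by $x_{n-1}$. The falling power is $x^{\underline{k}}=\prod_{i=0}^{k-1}(x-i)$. $\genfrac{[}{]}{0pt}{}{k}{m}$ is the (unsigned) Stirling number of the first kind (number of ways to arrange $k$ elements in $m$ cycles), and $\genfrac{\{}{\}}{0pt}{}{k}{m}$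 is the Stirling number of the second kind (number of partitions of a $k$-element set into $m$ nonempty subsets). *)

theory Defs
  imports
    "Jordan_Normal_Form.Missing_VectorSpace"
    "HOL-Algebra.Algebraic_Closure_Type"
    "HOL-Algebra.Multiplicative_Group"
    "HOL-Combinatorics.Stirling"
    "HOL-Library.Poly_Mapping"
begin

definition word_prod :: "('w, 'm) monoid_scheme \<Rightarrow> 'w list \<Rightarrow> 'w"
  where "word_prod W u = foldr (\<otimes>\<^bsub>W\<^esub>) u \<one>\<^bsub>W\<^esub>"

text \<open>
  The congruence on the words over \<open>S\<close> generated by the Coxeter relations
  \<open>(s t)\<^sup>m = 1\<close>, where \<open>m\<close> is the order of \<open>s t\<close> in \<open>W\<close>. The case \<open>s = t\<close> yields \<open>s s = 1\<close>,
  so that no formal inverses are needed and the quotient monoid is the group with generators \<open>S\<close>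
  and these relations. An infinite order is represented by \<open>0\<close> in the library and then gives the
  void relation.
\<close>

inductive coxeter_equiv :: "('w, 'm) monoid_scheme \<Rightarrow> 'w set \<Rightarrow> 'w list \<Rightarrow> 'w list \<Rightarrow> bool"
  for W S where
  refl: "u \<in> lists S \<Longrightarrow> coxeter_equiv W S u u"
| sym: "coxeter_equiv W S u v \<Longrightarrow> coxeter_equiv W S v u"
| trans: "coxeter_equiv W S u v \<Longrightarrow> coxeter_equiv W S v w \<Longrightarrow> coxeter_equiv W S u w"
| relation: "\<lbrakk> s \<in> S; t \<in> S; u \<in> lists S; v \<in> lists S \<rbrakk> \<Longrightarrow>
    coxeter_equiv W S (u @ concat (replicate (group.ord W (s \<otimes>\<^bsub>W\<^esub> t)) [s, t]) @ v) (u @ v)"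

text \<open>
  The last two assumptions say that the canonical homomorphism from the group with generators \<open>S\<close>
  and the Coxeter relations to \<open>W\<close> is surjective and injective, respectively.
\<close>

locale coxeter_system = group W for W (structure) +
  fixes S :: "'a set"
  assumes gens_closed: "S \<subseteq> carrier W"
    and gens_order: "s \<in> S \<Longrightarrow> ord s = 2"
    and generates: "generate W S = carrier W"
    and presentation: "\<lbrakk> u \<in> lists S; v \<in> lists S; word_prod W u = word_prod W v \<rbrakk> \<Longrightarrow>
      coxeter_equiv W S u v"

locale coxeter_system_A = coxeter_system W S for W (structure) and S +
  fixes s :: "nat \<Rightarrow> 'a" and n :: nat
  assumes gens_labelling: "bij_betw s {1..n} S"
    and adjacent: "\<lbrakk> 1 \<le> i; i \<le> n - 1 \<rbrakk> \<Longrightarrow> ord (s i \<otimes> s (i + 1)) = 3"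
    and nonadjacent: "\<lbrakk> 1 \<le> i; i + 1 < j; j \<le> n \<rbrakk> \<Longrightarrow> s i \<otimes> s j = s j \<otimes> s i"

definition cox_length :: "('w, 'm) monoid_scheme \<Rightarrow> 'w set \<Rightarrow> 'w \<Rightarrow> nat"
  where "cox_length W S w = (LEAST k. \<exists>u \<in> lists S. length u = k \<and> word_prod W u = w)"

definition min_coset_reps :: "('w, 'm) monoid_scheme \<Rightarrow> 'w set \<Rightarrow> 'w set \<Rightarrow> 'w set"
  where "min_coset_reps W S J =
    {w \<in> carrier W. \<forall>s \<in> J. cox_length W S (w \<otimes>\<^bsub>W\<^esub> s) > cox_length W S w}"


abbreviation rat_field :: "rat ring"
  where "rat_field \<equiv> ring_of_type_algebra"

text \<open>
  The group algebra consists of the formal linear combinations of elements of \<open>carrier G\<close>; only the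
  additive structure of the type \<^typ>\<open>'g \<Rightarrow>\<^sub>0 rat\<close> is used.
\<close>

definition group_algebra :: "('g, 'm) monoid_scheme \<Rightarrow> (rat, 'g \<Rightarrow>\<^sub>0 rat) module"
  where "group_algebra G = \<lparr>
    carrier = {f. Poly_Mapping.keys f \<subseteq> carrier G},
    monoid.mult = (\<lambda>f h. \<Sum>a \<in> Poly_Mapping.keys f. \<Sum>b \<in> Poly_Mapping.keys h.
      Poly_Mapping.single (a \<otimes>\<^bsub>G\<^esub> b) (Poly_Mapping.lookup f a * Poly_Mapping.lookup h b)),
    one = Poly_Mapping.single \<one>\<^bsub>G\<^esub> 1,
    ring.zero = 0,
    add = (+),
    module.smult = (\<lambda>c f. Poly_Mapping.map ((*) c) f)\<rparr>"

definition poly_algebra :: "(rat, rat poly) module"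
  where "poly_algebra = \<lparr>
    carrier = UNIV, monoid.mult = (*), one = 1, ring.zero = 0, add = (+), module.smult = Polynomial.smult\<rparr>"

definition quotient_algebra :: "(rat, 'a) module \<Rightarrow> 'a set \<Rightarrow> (rat, 'a set) module"
  where "quotient_algebra A I =
    ring.extend (A Quot I) (module.fields (\<lambda>c C. \<Union>a \<in> C. I +>\<^bsub>A\<^esub> (c \<odot>\<^bsub>A\<^esub> a)))"

text \<open>
  The library's \<open>subalgebra\<close> does not require closure under multiplication, hence the direct
  formulation by means of \<^const>\<open>subring\<close>.
\<close>

definition adjoin :: "(rat, 'a) module \<Rightarrow> 'a \<Rightarrow> (rat, 'a) module"
  where "adjoin A x = A\<lparr>carrier :=
    \<Inter>{B. subring B A \<and> (\<forall>c. \<forall>b \<in> B. c \<odot>\<^bsub>A\<^esub> b \<in> B) \<and> x \<in> B}\<rparr>"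

definition algebra_isomorphic :: "(rat, 'a) module \<Rightarrow> (rat, 'b) module \<Rightarrow> bool"
  where "algebra_isomorphic A B \<longleftrightarrow> ring_iso A B \<inter> LinearCombinations.module_hom rat_field A B \<noteq> {}"

definition family_basis :: "(rat, 'v) module \<Rightarrow> 'i set \<Rightarrow> ('i \<Rightarrow> 'v) \<Rightarrow> bool"
  where "family_basis V I b \<longleftrightarrow> inj_on b I \<and> vectorspace.basis rat_field V (b ` I)"

definition falling_power :: "nat \<Rightarrow> rat poly"
  where "falling_power k = (\<Prod>i<k. [:- of_nat i, 1:])"


definition x_elem :: "('w, 'm) monoid_scheme \<Rightarrow> 'w set \<Rightarrow> 'w set \<Rightarrow> ('w \<Rightarrow>\<^sub>0 rat)"
  where "x_elem W S J = (\<Sum>w \<in> min_coset_reps W S J. Poly_Mapping.single w 1)"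

definition xA :: "('w, 'm) monoid_scheme \<Rightarrow> 'w set \<Rightarrow> (nat \<Rightarrow> 'w) \<Rightarrow> nat \<Rightarrow> ('w \<Rightarrow>\<^sub>0 rat)"
  where "xA W S s j = x_elem W S (s ` {1..j})"

definition E_algebra ::
    "('w, 'm) monoid_scheme \<Rightarrow> 'w set \<Rightarrow> (nat \<Rightarrow> 'w) \<Rightarrow> nat \<Rightarrow> (rat, 'w \<Rightarrow>\<^sub>0 rat) module"
  where "E_algebra W S s n = adjoin (group_algebra W) (xA W S s (n - 1))"

end

theory Submission
  imports Defs
begin

text \<open>
  Let \<open>x = x\<^bsub>n-1\<^esub>\<close>. Everything follows from the identities
  \<open>x\<^sub>j x = x\<^bsub>j-1\<^esub> + (n - j) x\<^sub>j\<close> for \<open>j \<ge> 1\<close> and \<open>x\<^sub>0 x = (n + 1) x\<^sub>0\<close>: they show that the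
  falling power of exponent \<open>k \<le> n\<close> takes the value \<open>x\<^bsub>n-k\<^esub>\<close> at \<open>x\<close>, and that the one of exponent
  \<open>n + 1\<close> takes the value \<open>x\<^sub>0\<close> again. As the \<open>x\<^sub>j\<close> are linearly independent (compare the coefficients
  at the identity and at the generators), this determines the kernel of the evaluation at \<open>x\<close>.

  The summands of \<open>x\<close> are the ascending products \<open>c\<^sub>k = s\<^sub>k \<dots> s\<^sub>n\<close>, \<open>1 \<le> k \<le> n + 1\<close>. Right multiplication
  by \<open>c\<^sub>k\<close> with \<open>k > j + 1\<close> permutes \<open>X\<^sub>j\<close>, because \<open>c\<^sub>k\<close> is a product of generators that
  commute with \<open>s\<^sub>1, \<dots>, s\<^sub>j\<close>; and the sets \<open>X\<^sub>j c\<^sub>k\<close> with \<open>k \<le> j + 1\<close> partition \<open>X\<^bsub>j-1\<^esub>\<close>, because the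
  \<open>s\<^sub>k \<dots> s\<^sub>j\<close> represent the cosets of the parabolic subgroup of \<open>s\<^sub>1, \<dots>, s\<^bsub>j-1\<^esub>\<close> in that of
  \<open>s\<^sub>1, \<dots>, s\<^sub>j\<close>.

  Descents are handled without a root system: the parity of the number of times that a reflection
  occurs along a word is invariant under the Coxeter relations, so it defines the inversions of a
  group element, from which the exchange condition follows.
\<close>

section \<open>Inversions and the exchange condition\<close>

lemma word_prod_simps [simp]:
  "word_prod W [] = \<one>\<^bsub>W\<^esub>"
  "word_prod W (a # u) = a \<otimes>\<^bsub>W\<^esub> word_prod W u"
  by (simp_all add: word_prod_def)

context coxeter_system
begin

section \<open>Words in the involutive generators and their products\<close>

lemma gen_closed [simp]: "a \<in> S \<Longrightarrow> a \<in> carrier W"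
  using gens_closed by blast

lemma gen_square: "a \<in> S \<Longrightarrow> a \<otimes> a = \<one>"
  using pow_ord_eq_1[of a] gens_order[of a] by (simp add: numeral_2_eq_2)

lemma gen_square_left [simp]: "a \<in> S \<Longrightarrow> x \<in> carrier W \<Longrightarrow> a \<otimes> (a \<otimes> x) = x"
  by (simp add: m_assoc[symmetric] gen_square)

lemma gen_not_one: "a \<in> S \<Longrightarrow> a \<noteq> \<one>"
  using gens_order[of a] ord_eq_1[of a] by fastforce

lemma inv_gen: "a \<in> S \<Longrightarrow> inv a = a"
  by (simp add: gen_square inv_equality)

lemma lists_subset: "u \<in> lists J \<Longrightarrow> J \<subseteq> S \<Longrightarrow> u \<in> lists S"
  using lists_mono by blast

lemma rev_in_lists [simp]: "u \<in> lists J \<Longrightarrow> rev u \<in> lists J"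
  by (simp add: in_lists_conv_set)

lemma word_prod_closed [simp]: "u \<in> lists S \<Longrightarrow> word_prod W u \<in> carrier W"
  by (induction u) auto

lemma word_prod_append:
  "u \<in> lists S \<Longrightarrow> v \<in> lists S \<Longrightarrow> word_prod W (u @ v) = word_prod W u \<otimes> word_prod W v"
  by (induction u) (auto simp: m_assoc)

lemma word_prod_rev: "u \<in> lists S \<Longrightarrow> word_prod W (rev u) = inv (word_prod W u)"
proof (induction u)
  case (Cons a u)
  then have "rev u \<in> lists S" "a \<in> S" "u \<in> lists S" by auto
  then show ?case using Cons.IH by (simp add: word_prod_append inv_mult_group inv_gen)
qed simp

text \<open>Generators are their own inverses, so words without formal inverses already exhaust the
  generated subgroup.\<close>

lemma word_exists:
  assumes "w \<in> carrier W"
  obtains u where "u \<in> lists S" "word_prod W u = w"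
proof -
  have "w \<in> generate W S" using assms generates by simp
  then have "\<exists>u \<in> lists S. word_prod W u = w"
  proof induction
    case one
    show ?case by (intro bexI[of _ "[]"]) auto
  next
    case (incl a)
    then show ?case by (intro bexI[of _ "[a]"]) auto
  next
    case (inv a)
    then show ?case by (intro bexI[of _ "[a]"]) (auto simp: inv_gen)
  next
    case (eng x y)
    then obtain u v where "u \<in> lists S" "word_prod W u = x" "v \<in> lists S" "word_prod W v = y"
      by blast
    then show ?case by (intro bexI[of _ "u @ v"]) (auto simp: word_prod_append)
  qed
  then show ?thesis using that by blast
qed

text \<open>
  For a word \<open>a\<^sub>1 \<dots> a\<^sub>k\<close> the reflections \<open>a\<^sub>1 \<dots> a\<^sub>i \<dots> a\<^sub>1\<close>, \<open>1 \<le> i \<le> k\<close>, are counted modulo two.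
\<close>

primrec odd_refl :: "'a list \<Rightarrow> 'a \<Rightarrow> bool" where
  "odd_refl [] t = False"
| "odd_refl (a # u) t = ((t = a) \<noteq> odd_refl u (a \<otimes> t \<otimes> a))"

text \<open>A cocycle rule: the reflections contributed by \<open>v\<close> occur in
  \<open>u @ v\<close> conjugated by the element of \<open>u\<close>, so \<open>t\<close> is
  conjugated back before it is sought in \<open>v\<close>.\<close>

lemma odd_refl_append:
  "u \<in> lists S \<Longrightarrow> v \<in> lists S \<Longrightarrow> t \<in> carrier W \<Longrightarrow>
    odd_refl (u @ v) t = (odd_refl u t \<noteq> odd_refl v (inv (word_prod W u) \<otimes> t \<otimes> word_prod W u))"
proof (induction u arbitrary: t)
  case (Cons a u)
  then have "odd_refl (u @ v) (a \<otimes> t \<otimes> a) = (odd_refl u (a \<otimes> t \<otimes> a) \<noteq>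
      odd_refl v (inv (word_prod W u) \<otimes> (a \<otimes> t \<otimes> a) \<otimes> word_prod W u))"
    by auto
  moreover have "inv (word_prod W u) \<otimes> (a \<otimes> t \<otimes> a) \<otimes> word_prod W u =
      inv (word_prod W (a # u)) \<otimes> t \<otimes> word_prod W (a # u)"
    using Cons.prems by (simp add: inv_mult_group inv_gen m_assoc)
  ultimately show ?case by auto
qed simp

lemma word_prod_alternating:
  "a \<in> S \<Longrightarrow> b \<in> S \<Longrightarrow> word_prod W (concat (replicate k [a, b])) = (a \<otimes> b) [^] k"
proof (induction k)
  case (Suc k)
  then have "word_prod W (concat (replicate (Suc k) [a, b])) = (a \<otimes> b) \<otimes> (a \<otimes> b) [^] k"
    by (simp add: m_assoc)
  then show ?case using Suc.prems by (simp only: nat_pow_Suc2 gen_closed m_closed)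
qed simp

lemma alternating_in_lists: "a \<in> S \<Longrightarrow> b \<in> S \<Longrightarrow> concat (replicate k [a, b]) \<in> lists S"
  by (induction k) auto

lemma conj_swap:
  assumes "x \<in> carrier W" "y \<in> carrier W" "t \<in> carrier W"
  shows "inv x \<otimes> t \<otimes> x = y \<longleftrightarrow> t = x \<otimes> y \<otimes> inv x"
  using assms by (metis inv_closed inv_solve_left inv_solve_right m_assoc m_closed)

text \<open>Conjugation by the involution \<open>a\<close> inverts the rotation
  \<open>a \<otimes> b\<close> in the dihedral group of \<open>a\<close> and
  \<open>b\<close>.\<close>

lemma gen_conj_pow:
  assumes "a \<in> S" "b \<in> S"
  shows "a \<otimes> inv ((a \<otimes> b) [^] (k::nat)) = (a \<otimes> b) [^] k \<otimes> a"
proof (induction k)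
  case 0
  show ?case using assms by simp
next
  case (Suc k)
  have "a \<otimes> inv ((a \<otimes> b) [^] Suc k) = a \<otimes> inv (a \<otimes> b) \<otimes> inv ((a \<otimes> b) [^] k)"
    using assms by (simp add: inv_mult_group m_assoc)
  also have "\<dots> = (a \<otimes> b) \<otimes> (a \<otimes> inv ((a \<otimes> b) [^] k))"
    using assms by (simp add: inv_mult_group inv_gen m_assoc)
  also have "\<dots> = (a \<otimes> b) [^] Suc k \<otimes> a"
    unfolding Suc using assms by (simp only: nat_pow_Suc2 gen_closed m_closed nat_pow_closed m_assoc)
  finally show ?case .
qed

text \<open>The prefixes of the alternating word yield the reflections \<open>a\<close>,
  \<open>a b a\<close>, \<open>a b a b a\<close> and so on, which are the elements
  \<open>(a \<otimes> b) [^] i \<otimes> a\<close> for \<open>i = 0, 1, 2, ...\<close>. One element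
  may occur at several indices, hence the parity of a cardinality.\<close>

lemma odd_refl_alternating:
  assumes ab: "a \<in> S" "b \<in> S" and t: "t \<in> carrier W"
  shows "odd_refl (concat (replicate k [a, b])) t =
    odd (card {i. i < 2 * k \<and> t = (a \<otimes> b) [^] i \<otimes> a})"
proof (induction k)
  case (Suc k)
  let ?c = "(a \<otimes> b) [^] k"
  let ?r = "\<lambda>i::nat. (a \<otimes> b) [^] i \<otimes> a"
  let ?s = "inv ?c \<otimes> t \<otimes> ?c"
  have c: "?c \<in> carrier W" using ab by simp
  \<comment> \<open>A further pair \<open>a b\<close> contributes the indices \<open>2 * k\<close>
    and \<open>2 * k + 1\<close>: the conjugates of \<open>a\<close> and of
    \<open>a \<otimes> b \<otimes> a\<close> by \<open>?c\<close>.\<close>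
  have "?s = a \<longleftrightarrow> t = ?c \<otimes> a \<otimes> inv ?c" using conj_swap c t ab by simp
  also have "?c \<otimes> a \<otimes> inv ?c = ?r (2 * k)"
    using c ab gen_conj_pow[OF ab, of k] by (simp add: m_assoc mult_2 flip: nat_pow_mult)
  finally have 1: "?s = a \<longleftrightarrow> t = ?r (2 * k)" .
  have "a \<otimes> ?s \<otimes> a = b \<longleftrightarrow> ?s = a \<otimes> b \<otimes> a"
    using conj_swap[of a b ?s] c t ab by (simp add: inv_gen)
  also have "\<dots> \<longleftrightarrow> t = ?c \<otimes> (a \<otimes> b \<otimes> a) \<otimes> inv ?c" using conj_swap c t ab by simp
  also have "?c \<otimes> (a \<otimes> b \<otimes> a) \<otimes> inv ?c = (?c \<otimes> (a \<otimes> b)) \<otimes> (a \<otimes> inv ?c)"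
    using c ab by (simp add: m_assoc)
  also have "\<dots> = ?r (Suc (2 * k))"
  proof -
    have "(a \<otimes> b) [^] (Suc (2 * k)) = ?c \<otimes> (a \<otimes> b) \<otimes> ?c"
      using c ab by (simp only: nat_pow_Suc2 m_closed gen_closed mult_2 nat_pow_mult[symmetric])
        (simp only: nat_pow_Suc2[symmetric] nat_pow_Suc m_assoc[symmetric] m_closed gen_closed)
    then show ?thesis
      using c ab by (simp only: gen_conj_pow[OF ab] m_assoc m_closed gen_closed)
  qed
  finally have 2: "a \<otimes> ?s \<otimes> a = b \<longleftrightarrow> t = ?r (Suc (2 * k))" .
  have "odd_refl (concat (replicate (Suc k) [a, b])) t =
      odd_refl (concat (replicate k [a, b]) @ [a, b]) t"
    by (simp add: replicate_append_same[symmetric] del: replicate_append_same)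
  also have "\<dots> = (odd_refl (concat (replicate k [a, b])) t \<noteq> odd_refl [a, b] ?s)"
    using ab t alternating_in_lists word_prod_alternating by (subst odd_refl_append) auto
  also have "odd_refl [a, b] ?s = ((t = ?r (2 * k)) \<noteq> (t = ?r (Suc (2 * k))))"
    using 1 2 by auto
  finally have step: "odd_refl (concat (replicate (Suc k) [a, b])) t =
      (odd (card {i. i < 2 * k \<and> t = ?r i}) \<noteq> ((t = ?r (2 * k)) \<noteq> (t = ?r (Suc (2 * k)))))"
    unfolding Suc .
  have "{i. i < 2 * Suc k \<and> t = ?r i} = {i. i < 2 * k \<and> t = ?r i} \<union>
      ((if t = ?r (2 * k) then {2 * k} else {}) \<union> (if t = ?r (Suc (2 * k)) then {Suc (2 * k)} else {}))"
    by (auto simp: less_Suc_eq simp del: nat_pow_Suc)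
  then have "card {i. i < 2 * Suc k \<and> t = ?r i} = card {i. i < 2 * k \<and> t = ?r i} +
     card ((if t = ?r (2 * k) then {2 * k} else {}) \<union> (if t = ?r (Suc (2 * k)) then {Suc (2 * k)} else {}))"
    by (simp only:) (rule card_Un_disjoint, auto)
  then show ?case unfolding step by (auto simp del: nat_pow_Suc)
qed simp

text \<open>With \<open>m\<close> the order, the \<open>2 * m\<close> reflections of the relator run
  twice through one period of length \<open>m\<close>, so each is met an even number of times.
  Infinite order gives the empty word.\<close>

lemma odd_refl_relation:
  assumes ab: "a \<in> S" "b \<in> S" and t: "t \<in> carrier W"
  shows "\<not> odd_refl (concat (replicate (ord (a \<otimes> b)) [a, b])) t"
proof -
  let ?m = "ord (a \<otimes> b)"
  let ?P = "\<lambda>i::nat. t = (a \<otimes> b) [^] i \<otimes> a"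
  have P: "?P (i + ?m) = ?P i" for i
    using ab by (simp add: pow_ord_eq_1 flip: nat_pow_mult)
  have "{i. i < 2 * ?m \<and> ?P i} = {i. i < ?m \<and> ?P i} \<union> (\<lambda>i. i + ?m) ` {i. i < ?m \<and> ?P i}"
  proof (intro equalityI subsetI)
    fix i assume i: "i \<in> {i. i < 2 * ?m \<and> ?P i}"
    show "i \<in> {i. i < ?m \<and> ?P i} \<union> (\<lambda>i. i + ?m) ` {i. i < ?m \<and> ?P i}"
    proof (cases "i < ?m")
      case False
      then have "i = (i - ?m) + ?m" "i - ?m < ?m" using i by auto
      moreover from this have "?P (i - ?m)" using i P[of "i - ?m"] by auto
      ultimately show ?thesis by blast
    qed (use i in auto)
  qed (use P in auto)
  moreover have "card \<dots> = card {i. i < ?m \<and> ?P i} + card ((\<lambda>i. i + ?m) ` {i. i < ?m \<and> ?P i})"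
    by (rule card_Un_disjoint) auto
  ultimately have "card {i. i < 2 * ?m \<and> ?P i} = 2 * card {i. i < ?m \<and> ?P i}"
    by (simp add: card_image)
  then show ?thesis using odd_refl_alternating[OF ab t, of ?m] by simp
qed

text \<open>A relator has product one, so inserting it conjugates nothing behind it, and its own
  reflections cancel modulo two.\<close>

lemma coxeter_equiv_invariant:
  "coxeter_equiv W S u v \<Longrightarrow> u \<in> lists S \<and> v \<in> lists S \<and> word_prod W u = word_prod W v \<and>
    (\<forall>t \<in> carrier W. odd_refl u t = odd_refl v t)"
proof (induction rule: coxeter_equiv.induct)
  case (relation a b u v)
  let ?r = "concat (replicate (ord (a \<otimes> b)) [a, b])"
  have r: "?r \<in> lists S" "word_prod W ?r = \<one>"
    using relation alternating_in_lists word_prod_alternating pow_ord_eq_1 by auto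
  have rv: "word_prod W (?r @ v) = word_prod W v" "?r @ v \<in> lists S"
    using r relation by (auto simp: word_prod_append)
  have "odd_refl (?r @ v) t = odd_refl v t" if "t \<in> carrier W" for t
    using odd_refl_append[OF r(1), of v t] odd_refl_relation[of a b t] r that relation by simp
  then have "odd_refl (u @ ?r @ v) t = odd_refl (u @ v) t" if "t \<in> carrier W" for t
    using that relation rv by (simp add: odd_refl_append del: append_in_lists_conv)
  then show ?case using relation rv by (simp add: word_prod_append r(1))
qed auto

text \<open>For \<open>t\<close> in the group, every word for \<open>w\<close> gives the same
  answer: words with equal products are equivalent by \<open>presentation\<close>, and the parity is
  invariant.\<close>

definition inverts :: "'a \<Rightarrow> 'a \<Rightarrow> bool"
  where "inverts w t \<longleftrightarrow> (\<exists>u \<in> lists S. word_prod W u = w \<and> odd_refl u t)"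

lemma inverts_word_prod:
  assumes "u \<in> lists S" "t \<in> carrier W"
  shows "inverts (word_prod W u) t = odd_refl u t"
  using assms presentation coxeter_equiv_invariant unfolding inverts_def by metis

lemma not_inverts_one: "t \<in> carrier W \<Longrightarrow> \<not> inverts \<one> t"
  using inverts_word_prod[of "[]" t] by simp

text \<open>Appending \<open>a\<close> to a word for \<open>w\<close> adds a single reflection, the
  conjugate of \<open>a\<close> by \<open>w\<close>; only this one is toggled.\<close>

lemma inverts_mult_gen:
  assumes "w \<in> carrier W" "a \<in> S" "t \<in> carrier W"
  shows "inverts (w \<otimes> a) t = (inverts w t \<noteq> (t = w \<otimes> a \<otimes> inv w))"
proof -
  obtain u where u: "u \<in> lists S" "word_prod W u = w" using word_exists assms by blast
  then have "inverts (w \<otimes> a) t = odd_refl (u @ [a]) t"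
    using inverts_word_prod[of "u @ [a]" t] assms by (simp add: word_prod_append)
  then show ?thesis
    using u assms inverts_word_prod[of u t] conj_swap[of w a t] by (auto simp: odd_refl_append)
qed

text \<open>A right descent expressed without lengths; \<open>ascent_iff\<close> links it to
  \<open>cox_length\<close>.\<close>

definition descent :: "'a \<Rightarrow> 'a \<Rightarrow> bool"
  where "descent w a \<longleftrightarrow> inverts w (w \<otimes> a \<otimes> inv w)"

text \<open>An odd count is positive, so \<open>t\<close> is one of the reflections of the word, and
  multiplying by it from the left deletes the corresponding letter. The induction strips the first
  letter and conjugates \<open>t\<close> by it.\<close>

lemma odd_refl_exchange:
  assumes "u \<in> lists S" "t \<in> carrier W" "odd_refl u t"
  shows "\<exists>p a q. u = p @ a # q \<and> t \<otimes> word_prod W u = word_prod W (p @ q)"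
  using assms
proof (induction u arbitrary: t)
  case (Cons b u)
  then have b: "b \<in> S" "u \<in> lists S" by auto
  show ?case
  proof (cases "t = b")
    case True
    then have "b # u = [] @ b # u" "t \<otimes> word_prod W (b # u) = word_prod W ([] @ u)"
      using b by auto
    then show ?thesis by blast
  next
    case False
    then obtain p a q where u: "u = p @ a # q"
      and eq: "b \<otimes> t \<otimes> b \<otimes> word_prod W u = word_prod W (p @ q)"
      using Cons.IH[of "b \<otimes> t \<otimes> b"] Cons.prems b by auto
    have "t \<otimes> word_prod W (b # u) = b \<otimes> (b \<otimes> t \<otimes> b \<otimes> word_prod W u)"
      using b Cons.prems by (simp add: m_assoc)
    then have "b # u = (b # p) @ a # q" "t \<otimes> word_prod W (b # u) = word_prod W ((b # p) @ q)"
      using u eq by auto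
    then show ?thesis by blast
  qed
qed simp

text \<open>The conjugate \<open>t\<close> of \<open>a\<close> by \<open>w\<close> satisfies
  \<open>t \<otimes> w = w \<otimes> a\<close>, which turns the deletion above into the right-handed
  exchange condition.\<close>

lemma exchange:
  assumes "u \<in> lists S" "a \<in> S" "descent (word_prod W u) a"
  obtains p b q where "u = p @ b # q" "word_prod W u \<otimes> a = word_prod W (p @ q)"
proof -
  let ?w = "word_prod W u"
  have "odd_refl u (?w \<otimes> a \<otimes> inv ?w)"
    using assms inverts_word_prod unfolding descent_def by simp
  then obtain p b q where "u = p @ b # q" "?w \<otimes> a \<otimes> inv ?w \<otimes> ?w = word_prod W (p @ q)"
    using odd_refl_exchange assms by (metis gen_closed inv_closed m_closed word_prod_closed)
  then show ?thesis using that assms by (simp add: m_assoc)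
qed

section \<open>Length and descents\<close>

lemma cox_length_le: "u \<in> lists S \<Longrightarrow> cox_length W S (word_prod W u) \<le> length u"
  unfolding cox_length_def by (rule Least_le) blast

lemma reduced_word:
  assumes "w \<in> carrier W"
  obtains u where "u \<in> lists S" "word_prod W u = w" "length u = cox_length W S w"
proof -
  have "\<exists>k. \<exists>u \<in> lists S. length u = k \<and> word_prod W u = w" using word_exists[OF assms] by metis
  from LeastI_ex[OF this] show ?thesis using that unfolding cox_length_def by blast
qed

lemma descent_imp_length:
  assumes "w \<in> carrier W" "a \<in> S" "descent w a"
  shows "cox_length W S (w \<otimes> a) < cox_length W S w"
proof -
  obtain u where u: "u \<in> lists S" "word_prod W u = w" "length u = cox_length W S w"
    using reduced_word assms by blast
  obtain p b q where pq: "u = p @ b # q" "w \<otimes> a = word_prod W (p @ q)"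
    using exchange[of u a] u assms by metis
  then show ?thesis using cox_length_le[of "p @ q"] u by auto
qed

text \<open>Both \<open>w\<close> and \<open>w \<otimes> a\<close> conjugate \<open>a\<close> to the
  same reflection, and this is the one toggled between them.\<close>

lemma descent_mult_self:
  assumes "w \<in> carrier W" "a \<in> S"
  shows "descent (w \<otimes> a) a \<longleftrightarrow> \<not> descent w a"
proof -
  have "(w \<otimes> a) \<otimes> a \<otimes> inv (w \<otimes> a) = w \<otimes> a \<otimes> inv w"
    using assms by (simp add: inv_mult_group inv_gen m_assoc gen_square)
  then show ?thesis using assms unfolding descent_def by (simp add: inverts_mult_gen)
qed

lemma ascent_iff:
  assumes "w \<in> carrier W" "a \<in> S"
  shows "cox_length W S w < cox_length W S (w \<otimes> a) \<longleftrightarrow> \<not> descent w a"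
proof
  assume "\<not> descent w a"
  then have "descent (w \<otimes> a) a" using descent_mult_self assms by simp
  then show "cox_length W S w < cox_length W S (w \<otimes> a)"
    using descent_imp_length[of "w \<otimes> a" a] assms by (simp add: m_assoc gen_square)
qed (use descent_imp_length assms in fastforce)

lemma mem_min_coset_reps:
  "J \<subseteq> S \<Longrightarrow> w \<in> min_coset_reps W S J \<longleftrightarrow> w \<in> carrier W \<and> (\<forall>a \<in> J. \<not> descent w a)"
  unfolding min_coset_reps_def using ascent_iff by auto

text \<open>The tested reflection is the same for \<open>w\<close> and \<open>w \<otimes> b\<close>,
  since \<open>b\<close> commutes with \<open>a\<close>; the toggled one is the conjugate of
  \<open>b\<close>, hence a different one.\<close>

lemma descent_mult_commuting:
  assumes "w \<in> carrier W" "a \<in> S" "b \<in> S" "a \<noteq> b" "a \<otimes> b = b \<otimes> a"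
  shows "descent (w \<otimes> b) a \<longleftrightarrow> descent w a"
proof -
  have "(w \<otimes> b) \<otimes> a \<otimes> inv (w \<otimes> b) = w \<otimes> (b \<otimes> a \<otimes> b) \<otimes> inv w"
    using assms(1-3) by (simp add: inv_mult_group inv_gen m_assoc)
  also have "b \<otimes> a \<otimes> b = a"
    using assms by (metis gen_closed gen_square_left m_assoc)
  finally have "(w \<otimes> b) \<otimes> a \<otimes> inv (w \<otimes> b) = w \<otimes> a \<otimes> inv w" .
  then show ?thesis using assms unfolding descent_def by (simp add: inverts_mult_gen)
qed

text \<open>Both sides test the conjugate of \<open>a \<otimes> b \<otimes> a\<close> by
  \<open>w\<close>, and neither multiplication toggles it, because this braid element is neither
  \<open>a\<close> nor \<open>b\<close>.\<close>

lemma descent_mult_braid: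
  assumes "w \<in> carrier W" "a \<in> S" "b \<in> S" "a \<noteq> b" "a \<otimes> b \<otimes> a = b \<otimes> a \<otimes> b"
  shows "descent (w \<otimes> b) a \<longleftrightarrow> descent (w \<otimes> a) b"
proof -
  have *: "x \<noteq> x \<otimes> y \<otimes> x" if "x \<in> S" "y \<in> S" "x \<otimes> y \<otimes> x = y \<otimes> x \<otimes> y" "x \<noteq> y" for x y
  proof
    assume eq: "x = x \<otimes> y \<otimes> x"
    then have "x \<otimes> \<one> = x \<otimes> (y \<otimes> x)" using that by (simp add: m_assoc)
    then have "y \<otimes> x = \<one>" using that by (metis gen_closed l_cancel m_closed one_closed)
    then have "y = x" using that by (metis gen_closed inv_equality inv_gen)
    then show False using that by simp
  qed
  have 1: "(w \<otimes> x) \<otimes> y \<otimes> inv (w \<otimes> x) = w \<otimes> (x \<otimes> y \<otimes> x) \<otimes> inv w" if "x \<in> S" "y \<in> S" for x y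
    using assms that by (simp add: inv_mult_group inv_gen m_assoc)
  have 2: "descent (w \<otimes> x) y \<longleftrightarrow> inverts w (w \<otimes> (x \<otimes> y \<otimes> x) \<otimes> inv w)"
    if "x \<in> S" "y \<in> S" "x \<otimes> y \<otimes> x = y \<otimes> x \<otimes> y" "x \<noteq> y" for x y
    using *[OF that] assms(1) that unfolding descent_def 1[OF that(1,2)] by (simp add: inverts_mult_gen)
  show ?thesis using 2[of a b] 2[of b a] assms by simp
qed

lemma not_descent_gen:
  assumes "a \<in> S" "b \<in> S" "a \<noteq> b"
  shows "\<not> descent b a"
proof -
  have "\<not> inverts (\<one> \<otimes> b) (b \<otimes> a \<otimes> inv b)"
  proof -
    have "b \<otimes> a \<otimes> inv b \<noteq> b"
    proof
      assume "b \<otimes> a \<otimes> inv b = b"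
      then have "b \<otimes> a = b \<otimes> b" using assms by (metis gen_closed inv_solve_right m_closed)
      then show False using assms by simp
    qed
    then show ?thesis
      using assms not_inverts_one[of "b \<otimes> a \<otimes> inv b"] inverts_mult_gen[of \<one> b "b \<otimes> a \<otimes> inv b"] by simp
  qed
  then show ?thesis using assms unfolding descent_def by simp
qed

lemma descent_gen: "a \<in> S \<Longrightarrow> descent a a"
  using descent_mult_self[of \<one> a] not_inverts_one[of a] unfolding descent_def by simp

section \<open>Shortest representatives of the cosets of a parabolic subgroup\<close>

text \<open>The exchange condition is applied to a reduced word \<open>u\<close> of \<open>m\<close>
  followed by \<open>p\<close>. If the deleted letter belonged to \<open>u\<close>, the coset of
  \<open>m\<close> would contain an element shorter than \<open>m\<close>; so it belongs to
  \<open>p\<close>.\<close>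

lemma min_length_descent:
  assumes J: "J \<subseteq> S" and m: "m \<in> carrier W"
    and min: "\<And>p. p \<in> lists J \<Longrightarrow> cox_length W S m \<le> cox_length W S (m \<otimes> word_prod W p)"
    and p: "p \<in> lists J" and a: "a \<in> J" and d: "descent (m \<otimes> word_prod W p) a"
  shows "\<exists>q \<in> lists J. length q < length p \<and> word_prod W q = word_prod W p \<otimes> a"
proof -
  obtain u where u: "u \<in> lists S" "word_prod W u = m" "length u = cox_length W S m"
    using reduced_word m by blast
  have pS: "p \<in> lists S" using lists_subset p J by blast
  have aS: "a \<in> S" using a J by blast
  have up: "word_prod W (u @ p) = m \<otimes> word_prod W p" using u pS by (simp add: word_prod_append)
  obtain x b y where xy: "u @ p = x @ b # y" "m \<otimes> word_prod W p \<otimes> a = word_prod W (x @ y)"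
    using exchange[of "u @ p" a] u pS aS d up by (metis append_in_lists_conv)
  consider r where "u = x @ b # r" "y = r @ p" | r where "x = u @ r" "p = r @ b # y"
  proof -
    obtain r where "u = x @ r \<and> r @ p = b # y \<or> u @ r = x \<and> p = r @ b # y"
      using xy(1) by (auto simp: append_eq_append_conv2)
    then show ?thesis using that by (cases r) auto
  qed
  then show ?thesis
  proof cases
    case 1
    have r: "x \<in> lists S" "r \<in> lists S" using u 1 by auto
    \<comment> \<open>\<open>p @ [a] @ rev p\<close> is a word over \<open>J\<close> for a conjugate
      of \<open>a\<close>, so \<open>min\<close> applies to the element that arises from
      \<open>u\<close> by the deletion.\<close>
    have "m \<otimes> word_prod W (p @ [a] @ rev p) = word_prod W (x @ r)"
    proof -
      have "m \<otimes> word_prod W (p @ [a] @ rev p) = (m \<otimes> word_prod W p \<otimes> a) \<otimes> inv (word_prod W p)"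
        using m pS aS by (simp add: word_prod_append word_prod_rev m_assoc)
      also have "m \<otimes> word_prod W p \<otimes> a = word_prod W (x @ r) \<otimes> word_prod W p"
        using xy(2) 1 r pS by (simp add: word_prod_append m_assoc)
      finally show ?thesis using r pS by (simp add: m_assoc)
    qed
    then have "cox_length W S m \<le> cox_length W S (word_prod W (x @ r))"
      using min[of "p @ [a] @ rev p"] p a by simp
    also have "\<dots> \<le> length (x @ r)" using cox_length_le[of "x @ r"] r by simp
    finally show ?thesis using u 1 by simp
  next
    case 2
    have r: "r \<in> lists S" "y \<in> lists S" "r @ y \<in> lists J"
      using p pS unfolding 2(2) by auto
    have "m \<otimes> (word_prod W p \<otimes> a) = m \<otimes> word_prod W (r @ y)"
      using xy(2) u r m pS aS unfolding 2(1) by (simp add: word_prod_append m_assoc)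
    then have "word_prod W p \<otimes> a = word_prod W (r @ y)" using m pS aS r by simp
    then show ?thesis using r(3) unfolding 2(2) by (intro bexI[of _ "r @ y"]) simp_all
  qed
qed

text \<open>Otherwise a shortest \<open>J\<close>-word for the second factor ends in some
  \<open>a\<close>. As \<open>a\<close> is no descent of the product, it is one before
  \<open>a\<close> is appended, and the previous lemma produces a still shorter word.\<close>

lemma min_length_unique:
  assumes J: "J \<subseteq> S" and m: "m \<in> carrier W"
    and min: "\<And>p. p \<in> lists J \<Longrightarrow> cox_length W S m \<le> cox_length W S (m \<otimes> word_prod W p)"
    and p: "p \<in> lists J" and w: "m \<otimes> word_prod W p \<in> min_coset_reps W S J"
  shows "word_prod W p = \<one>"
proof -
  define k where "k = (LEAST k. \<exists>q \<in> lists J. length q = k \<and> word_prod W q = word_prod W p)"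
  have "\<exists>k. \<exists>q \<in> lists J. length q = k \<and> word_prod W q = word_prod W p" using p by blast
  from LeastI_ex[OF this] obtain q where q: "q \<in> lists J" "length q = k" "word_prod W q = word_prod W p"
    unfolding k_def by blast
  have least: "k \<le> length q'" if "q' \<in> lists J" "word_prod W q' = word_prod W p" for q'
    unfolding k_def using that by (intro Least_le) blast
  show ?thesis
  proof (cases q rule: rev_cases)
    case Nil
    then show ?thesis using q by simp
  next
    case (snoc r a)
    have r: "r \<in> lists J" "r \<in> lists S" "a \<in> J" "a \<in> S" using snoc q J lists_subset by auto
    have pa: "word_prod W p = word_prod W r \<otimes> a"
      unfolding q(3)[symmetric] snoc using r by (simp add: word_prod_append)
    then have wa: "m \<otimes> word_prod W p = (m \<otimes> word_prod W r) \<otimes> a"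
      using r m by (simp add: m_assoc)
    have "\<not> descent (m \<otimes> word_prod W p) a"
      using w r J mem_min_coset_reps by blast
    then have "descent (m \<otimes> word_prod W r) a" using wa descent_mult_self r m by simp
    then obtain r' where r': "r' \<in> lists J" "length r' < length r" "word_prod W r' = word_prod W r \<otimes> a"
      using min_length_descent[OF J m min r(1) r(3)] by blast
    then have "word_prod W r' = word_prod W p" using pa by simp
    then show ?thesis using least[of r'] r' snoc q by simp
  qed
qed

text \<open>An element of least length in the coset of \<open>v\<close> has no descent in
  \<open>J\<close>.\<close>

lemma min_coset_reps_min_length:
  assumes J: "J \<subseteq> S" and v: "v \<in> carrier W"
  obtains m p where "m \<in> min_coset_reps W S J" "p \<in> lists J" "v = m \<otimes> word_prod W p"
    "\<And>q. q \<in> lists J \<Longrightarrow> cox_length W S m \<le> cox_length W S (m \<otimes> word_prod W q)"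
proof -
  obtain p where p: "p \<in> lists J"
    "\<And>q. q \<in> lists J \<Longrightarrow> cox_length W S (v \<otimes> word_prod W p) \<le> cox_length W S (v \<otimes> word_prod W q)"
    using ex_has_least_nat[of "\<lambda>p. p \<in> lists J" "[]" "\<lambda>p. cox_length W S (v \<otimes> word_prod W p)"]
    by auto
  have pS: "p \<in> lists S" using p lists_subset J by blast
  define m where "m = v \<otimes> word_prod W p"
  have m: "m \<in> carrier W" using v pS by (simp add: m_def)
  have min: "cox_length W S m \<le> cox_length W S (m \<otimes> word_prod W q)" if "q \<in> lists J" for q
    using p(2)[of "p @ q"] p(1) that v pS lists_subset[OF that J]
    by (simp add: m_def word_prod_append m_assoc)
  have "\<not> descent m a" if "a \<in> J" for a
    using descent_imp_length[OF m, of a] min[of "[a]"] that J by fastforce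
  then have "m \<in> min_coset_reps W S J" using m J mem_min_coset_reps by blast
  moreover have "rev p \<in> lists J" using p(1) by simp
  moreover have "v = m \<otimes> word_prod W (rev p)"
    using v pS by (simp add: m_def word_prod_rev m_assoc)
  ultimately show ?thesis using that min by blast
qed

text \<open>Both representatives coincide with a shortest element \<open>m\<close> of the coset, by
  two uses of \<open>min_length_unique\<close>.\<close>

lemma min_coset_reps_unique:
  assumes J: "J \<subseteq> S" and w: "w \<in> min_coset_reps W S J" and p: "p \<in> lists J"
    and wp: "w \<otimes> word_prod W p \<in> min_coset_reps W S J"
  shows "word_prod W p = \<one>"
proof -
  have wc: "w \<in> carrier W" using w J mem_min_coset_reps by blast
  obtain m q where m: "m \<in> min_coset_reps W S J" "q \<in> lists J" "w = m \<otimes> word_prod W q"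
    "\<And>q. q \<in> lists J \<Longrightarrow> cox_length W S m \<le> cox_length W S (m \<otimes> word_prod W q)"
    using min_coset_reps_min_length[OF J wc] by blast
  have mc: "m \<in> carrier W" using m J mem_min_coset_reps by blast
  have S: "p \<in> lists S" "q \<in> lists S" using p m J lists_subset by auto
  have q1: "word_prod W q = \<one>"
    using min_length_unique[OF J mc m(4,2)] w m(3) by simp
  then show ?thesis
    using min_length_unique[OF J mc m(4) p] wp m(3) mc by simp
qed

text \<open>By uniqueness \<open>w\<close> itself is shortest in its coset, so
  \<open>min_length_descent\<close> applies to it.\<close>

lemma min_coset_reps_descent:
  assumes J: "J \<subseteq> S" and w: "w \<in> min_coset_reps W S J" and p: "p \<in> lists J" and a: "a \<in> J"
    and d: "descent (w \<otimes> word_prod W p) a"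
  shows "\<exists>q \<in> lists J. length q < length p \<and> word_prod W q = word_prod W p \<otimes> a"
proof -
  have wc: "w \<in> carrier W" using w J mem_min_coset_reps by blast
  obtain m q where m: "m \<in> min_coset_reps W S J" "q \<in> lists J" "w = m \<otimes> word_prod W q"
    "\<And>q. q \<in> lists J \<Longrightarrow> cox_length W S m \<le> cox_length W S (m \<otimes> word_prod W q)"
    using min_coset_reps_min_length[OF J wc] by blast
  have mc: "m \<in> carrier W" using m J mem_min_coset_reps by blast
  have "word_prod W q = \<one>" using min_coset_reps_unique[OF J m(1,2)] w m(3) by simp
  then show ?thesis using min_length_descent[OF J mc m(4) p a] d m(3) mc by simp
qed

text \<open>Neither the identity nor \<open>a\<close> has a descent in \<open>J\<close>; if
  \<open>a\<close> were a product over \<open>J\<close>, the two would be distinct representatives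
  of one coset.\<close>

lemma not_in_parabolic:
  assumes J: "J \<subseteq> S" and a: "a \<in> S - J" and p: "p \<in> lists J"
  shows "word_prod W p \<noteq> a"
proof
  assume eq: "word_prod W p = a"
  have "\<one> \<in> min_coset_reps W S J"
    unfolding mem_min_coset_reps[OF J] descent_def using J not_inverts_one by auto
  moreover have "a \<in> min_coset_reps W S J"
    unfolding mem_min_coset_reps[OF J] using J not_descent_gen[of _ a] a by auto
  ultimately have "word_prod W p = \<one>"
    using min_coset_reps_unique[OF J, of \<one> p] p eq a by simp
  then show False using eq a gen_not_one by blast
qed

end

section \<open>Coset representatives in type A\<close>

context coxeter_system
begin

lemma gen_commute_word_prod:
  assumes "a \<in> S" "u \<in> lists S" "\<And>b. b \<in> set u \<Longrightarrow> a \<otimes> b = b \<otimes> a"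
  shows "a \<otimes> word_prod W u = word_prod W u \<otimes> a"
  using assms(2,3)
proof (induction u)
  case (Cons b u)
  then have b: "b \<in> S" "u \<in> lists S" "a \<otimes> b = b \<otimes> a" by auto
  have IH: "a \<otimes> word_prod W u = word_prod W u \<otimes> a" using Cons by auto
  have "a \<otimes> word_prod W (b # u) = (a \<otimes> b) \<otimes> word_prod W u" using b(1,2) assms(1) by (simp add: m_assoc)
  also have "\<dots> = b \<otimes> (a \<otimes> word_prod W u)" unfolding b(3) using b(1,2) assms(1) by (simp add: m_assoc)
  also have "\<dots> = word_prod W (b # u) \<otimes> a" unfolding IH using b(1,2) assms(1) by (simp add: m_assoc)
  finally show ?case .
qed (use assms in simp)

lemma descent_mult_word_prod:
  assumes "a \<in> S" "u \<in> lists S" "w \<in> carrier W"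
    "\<And>b. b \<in> set u \<Longrightarrow> a \<noteq> b \<and> a \<otimes> b = b \<otimes> a"
  shows "descent (w \<otimes> word_prod W u) a \<longleftrightarrow> descent w a"
  using assms(2-4)
proof (induction u arbitrary: w)
  case (Cons b u)
  then have b: "b \<in> S" "u \<in> lists S" "a \<noteq> b" "a \<otimes> b = b \<otimes> a" by auto
  have "descent (w \<otimes> word_prod W (b # u)) a \<longleftrightarrow> descent ((w \<otimes> b) \<otimes> word_prod W u) a"
    using b Cons.prems(1) by (simp add: m_assoc)
  also have "\<dots> \<longleftrightarrow> descent (w \<otimes> b) a" using b(1,2) Cons by auto
  finally show ?case using descent_mult_commuting[OF Cons.prems(1) assms(1) b(1,3,4)] by simp
qed simp

end

context coxeter_system_A
begin

section \<open>The relations of type A and products of consecutive generators\<close>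

lemma s_closed [simp]: "1 \<le> i \<Longrightarrow> i \<le> n \<Longrightarrow> s i \<in> S"
  using bij_betwE[OF gens_labelling] by simp

lemma s_eq_iff [simp]: "1 \<le> i \<Longrightarrow> i \<le> n \<Longrightarrow> 1 \<le> j \<Longrightarrow> j \<le> n \<Longrightarrow> s i = s j \<longleftrightarrow> i = j"
  using inj_on_eq_iff[OF bij_betw_imp_inj_on[OF gens_labelling], of i j] by simp

lemma S_eq: "S = s ` {1..n}"
  using bij_betw_imp_surj_on[OF gens_labelling] by simp

lemma parabolic_subset: "j \<le> n \<Longrightarrow> s ` {1..j} \<subseteq> S"
  by auto

lemma s_commute:
  assumes "1 \<le> i" "i \<le> n" "1 \<le> j" "j \<le> n" "i + 1 < j \<or> j + 1 < i"
  shows "s i \<otimes> s j = s j \<otimes> s i"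
  using assms nonadjacent[of i j] nonadjacent[of j i] by auto

lemma s_braid:
  assumes "1 \<le> i" "i + 1 \<le> n"
  shows "s i \<otimes> s (i + 1) \<otimes> s i = s (i + 1) \<otimes> s i \<otimes> s (i + 1)"
proof -
  let ?a = "s i" and ?b = "s (i + 1)"
  have ab: "?a \<in> S" "?b \<in> S" using assms by auto
  have "(?a \<otimes> ?b) [^] (3::nat) = \<one>"
    using adjacent[of i] pow_ord_eq_1[of "?a \<otimes> ?b"] assms ab by simp
  then have "(?a \<otimes> ?b \<otimes> ?a) \<otimes> (?b \<otimes> ?a \<otimes> ?b) = \<one>"
    using ab by (simp add: numeral_3_eq_3 m_assoc)
  moreover have "inv (?b \<otimes> ?a \<otimes> ?b) = ?b \<otimes> ?a \<otimes> ?b"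
    using ab by (simp add: inv_mult_group inv_gen m_assoc)
  ultimately show ?thesis
    using ab inv_equality[of "?a \<otimes> ?b \<otimes> ?a" "?b \<otimes> ?a \<otimes> ?b"] by simp
qed

text \<open>The \<open>c\<^sub>k\<close> of the overview is \<open>ascending k n\<close>; for
  \<open>k = Suc j\<close> the empty product \<open>\<one>\<close> is included as the trivial coset
  representative.\<close>

definition ascending :: "nat \<Rightarrow> nat \<Rightarrow> 'a"
  where "ascending k j = word_prod W (map s [k..<Suc j])"

lemma ascending_word: "1 \<le> k \<Longrightarrow> j \<le> n \<Longrightarrow> map s [k..<Suc j] \<in> lists S"
  by auto

lemma ascending_closed [simp]: "1 \<le> k \<Longrightarrow> j \<le> n \<Longrightarrow> ascending k j \<in> carrier W"
  unfolding ascending_def by (rule word_prod_closed[OF ascending_word])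

lemma ascending_empty [simp]: "j < k \<Longrightarrow> ascending k j = \<one>"
  by (simp add: ascending_def)

lemma ascending_first:
  assumes "k \<le> j"
  shows "ascending k j = s k \<otimes> ascending (Suc k) j"
  using assms by (simp add: ascending_def upt_conv_Cons del: upt_Suc)

lemma ascending_split:
  assumes "1 \<le> k" "k \<le> Suc i" "i \<le> j" "j \<le> n"
  shows "ascending k j = ascending k i \<otimes> ascending (Suc i) j"
proof -
  have "[k..<Suc j] = [k..<Suc i] @ [Suc i..<Suc j]"
    using assms upt_add_eq_append[of k "Suc i" "j - i"] by simp
  then show ?thesis
    using ascending_word[of k i] ascending_word[of "Suc i" j] assms
    unfolding ascending_def by (simp only: map_append word_prod_append)
qed

lemma s_commute_ascending:
  assumes "1 \<le> i" "i \<le> n" "1 \<le> k" "j \<le> n" "i + 1 < k \<or> j + 1 < i"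
  shows "s i \<otimes> ascending k j = ascending k j \<otimes> s i"
  unfolding ascending_def
proof (rule gen_commute_word_prod)
  fix b assume "b \<in> set (map s [k..<Suc j])"
  then obtain l where "b = s l" "k \<le> l" "l \<le> j" by (auto simp del: upt_Suc)
  moreover from this have "s i \<otimes> s l = s l \<otimes> s i" using assms by (intro s_commute) auto
  ultimately show "s i \<otimes> b = b \<otimes> s i" by simp
qed (use assms ascending_word in \<open>simp_all del: upt_Suc\<close>)

lemma descent_mult_ascending:
  assumes "1 \<le> i" "i \<le> n" "1 \<le> k" "j \<le> n" "i + 1 < k \<or> j + 1 < i" "w \<in> carrier W"
  shows "descent (w \<otimes> ascending k j) (s i) \<longleftrightarrow> descent w (s i)"
  unfolding ascending_def
proof (rule descent_mult_word_prod)
  fix b assume "b \<in> set (map s [k..<Suc j])"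
  then obtain l where l: "b = s l" "k \<le> l" "l \<le> j" by (auto simp del: upt_Suc)
  then have "s i \<noteq> s l" using assms by (subst s_eq_iff) auto
  moreover have "s i \<otimes> s l = s l \<otimes> s i" using assms l by (intro s_commute) auto
  ultimately show "s i \<noteq> b \<and> s i \<otimes> b = b \<otimes> s i" using l by simp
qed (use assms ascending_word in \<open>simp_all del: upt_Suc\<close>)

text \<open>\<open>s i\<close> commutes with the factors before \<open>s (i - 1)\<close>, the braid
  relation then leaves \<open>s (i - 1)\<close> behind \<open>s i\<close>, and this commutes with
  the factors from \<open>s (i + 1)\<close> on.\<close>

lemma s_mult_ascending:
  assumes "1 \<le> k" "k < i" "i \<le> j" "j \<le> n"
  shows "s i \<otimes> ascending k j = ascending k j \<otimes> s (i - 1)"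
proof -
  define h where "h = i - 1"
  have h: "i = h + 1" "k \<le> h" "1 \<le> h" "h + 1 \<le> n" using assms by (auto simp: h_def)
  let ?x = "ascending k (h - 1)" and ?y = "ascending (i + 1) j"
  have xy: "?x \<in> carrier W" "?y \<in> carrier W" using assms h by auto
  have S: "s h \<in> S" "s i \<in> S" using assms h by auto
  have "ascending k j = ?x \<otimes> ascending h j"
    using ascending_split[of k "h - 1" j] assms h by simp
  also have "ascending h j = s h \<otimes> (s i \<otimes> ?y)"
    using ascending_first[of h j] ascending_first[of i j] assms h by simp
  finally have eq: "ascending k j = ?x \<otimes> (s h \<otimes> (s i \<otimes> ?y))" .
  have "s i \<otimes> ascending k j = (s i \<otimes> ?x) \<otimes> (s h \<otimes> (s i \<otimes> ?y))"
    unfolding eq using xy S by (simp add: m_assoc)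
  also have "s i \<otimes> ?x = ?x \<otimes> s i" using s_commute_ascending[of i k "h - 1"] assms h by auto
  also have "?x \<otimes> s i \<otimes> (s h \<otimes> (s i \<otimes> ?y)) = ?x \<otimes> ((s i \<otimes> s h \<otimes> s i) \<otimes> ?y)"
    using xy S by (simp add: m_assoc)
  also have "s i \<otimes> s h \<otimes> s i = s h \<otimes> s i \<otimes> s h" using s_braid[of h] h by simp
  also have "?x \<otimes> (s h \<otimes> s i \<otimes> s h \<otimes> ?y) = ?x \<otimes> (s h \<otimes> (s i \<otimes> (s h \<otimes> ?y)))"
    using xy S by (simp add: m_assoc)
  also have "s h \<otimes> ?y = ?y \<otimes> s h" using s_commute_ascending[of h "i + 1" j] assms h by auto
  also have "?x \<otimes> (s h \<otimes> (s i \<otimes> (?y \<otimes> s h))) = ascending k j \<otimes> s h"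
    unfolding eq using xy S by (simp add: m_assoc)
  finally show ?thesis by (simp add: h_def)
qed

text \<open>Left multiplication by a generator preserves this form: \<open>s i\<close> either passes
  through the ascending product and is absorbed into \<open>q\<close>, or lengthens or shortens the
  product at its front.\<close>

lemma parabolic_decomposition:
  assumes "1 \<le> j" "j \<le> n" "p \<in> lists (s ` {1..j})"
  shows "\<exists>k \<in> {1..Suc j}. \<exists>q \<in> lists (s ` {1..j - 1}). word_prod W p = ascending k j \<otimes> word_prod W q"
  using assms(3)
proof (induction p)
  case Nil
  show ?case using assms by (intro bexI[of _ "Suc j"] bexI[of _ "[]"]) auto
next
  case (Cons a p)
  then obtain i where i: "a = s i" "1 \<le> i" "i \<le> j" by auto
  from Cons.IH obtain k q where kq: "k \<in> {1..Suc j}" "q \<in> lists (s ` {1..j - 1})"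
    "word_prod W p = ascending k j \<otimes> word_prod W q" by blast
  have qS: "q \<in> lists S" using kq(2) assms parabolic_subset[of "j - 1"] lists_subset by auto
  have si: "s i \<in> S" using i assms by auto
  have k: "1 \<le> k" "k \<le> Suc j" using kq by auto
  have ac: "ascending k j \<in> carrier W" using k assms by simp
  have eq: "word_prod W (a # p) = (s i \<otimes> ascending k j) \<otimes> word_prod W q"
    using kq(3) i qS si ac by (simp add: m_assoc)
  \<comment> \<open>\<open>l\<close> is the index with which the generator emerges on the right:
    \<open>i\<close> or \<open>i - 1\<close>.\<close>
  have move: ?case if "s i \<otimes> ascending k j = ascending k j \<otimes> s l" "1 \<le> l" "l \<le> j - 1" for l
  proof -
    have "word_prod W (a # p) = ascending k j \<otimes> word_prod W (s l # q)"
      using eq that assms qS ac by (simp add: m_assoc)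
    moreover have "s l # q \<in> lists (s ` {1..j - 1})" using kq that by auto
    ultimately show ?thesis using kq(1) by blast
  qed
  consider "i + 1 < k" | "k = Suc i" | "k = i" | "k < i" by linarith
  then show ?case
  proof cases
    case 1
    then show ?thesis using move[of i] s_commute_ascending[of i k j] i k assms by auto
  next
    case 2
    then have "word_prod W (a # p) = ascending i j \<otimes> word_prod W q"
      using eq ascending_first[of i j] i by simp
    then show ?thesis using i kq(2) by (intro bexI[of _ i] bexI[of _ q]) auto
  next
    case 3
    then have "word_prod W (a # p) = ascending (Suc i) j \<otimes> word_prod W q"
      using eq ascending_first[of i j] i si assms by simp
    then show ?thesis using i kq(2) by (intro bexI[of _ "Suc i"] bexI[of _ q]) auto
  next
    case 4
    then show ?thesis using move[of "i - 1"] s_mult_ascending[of k i j] i k assms by auto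
  qed
qed

text \<open>The decomposition bounds each parabolic subgroup by the preceding one. Finiteness makes
  the sums over coset representatives below meaningful.\<close>

lemma finite_parabolic: "j \<le> n \<Longrightarrow> finite (word_prod W ` lists (s ` {1..j}))"
proof (induction j)
  case (Suc j)
  let ?P = "\<lambda>j. word_prod W ` lists (s ` {1..j})"
  have "?P (Suc j) \<subseteq> (\<lambda>(k, x). ascending k (Suc j) \<otimes> x) ` ({1..Suc (Suc j)} \<times> ?P j)"
    using parabolic_decomposition[of "Suc j"] Suc.prems by fastforce
  moreover have "finite ((\<lambda>(k, x). ascending k (Suc j) \<otimes> x) ` ({1..Suc (Suc j)} \<times> ?P j))"
    using Suc by (intro finite_imageI[OF finite_cartesian_product]) simp_all
  ultimately show ?case by (rule finite_subset)
qed simp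

lemma finite_carrier: "finite (carrier W)"
proof -
  have "carrier W \<subseteq> word_prod W ` lists (s ` {1..n})"
    using word_exists S_eq by (metis imageI subsetI)
  then show ?thesis using finite_parabolic finite_subset by blast
qed

section \<open>The coset representatives for initial segments of the generators\<close>

definition reps :: "nat \<Rightarrow> 'a set"
  where "reps j = min_coset_reps W S (s ` {1..j})"

lemma mem_reps: "j \<le> n \<Longrightarrow> w \<in> reps j \<longleftrightarrow> w \<in> carrier W \<and> (\<forall>i \<in> {1..j}. \<not> descent w (s i))"
  unfolding reps_def by (subst mem_min_coset_reps[OF parabolic_subset]) auto

lemma finite_reps [simp]: "finite (reps j)"
  using finite_carrier by (rule rev_finite_subset) (auto simp: reps_def min_coset_reps_def)

text \<open>A generator with \<open>i + 1 < k\<close> is a descent of the product only if it is one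
  of \<open>w\<close>. Inside the product, \<open>k \<le> i\<close>, the test moves to
  \<open>s (i + 1)\<close> at \<open>w\<close>, hence the drop from \<open>j\<close> to
  \<open>j - 1\<close>. The borderline \<open>k = Suc i\<close> uses the shortening lemma for
  representatives.\<close>

lemma reps_mult_ascending:
  assumes "j \<le> n" "w \<in> reps j" "1 \<le> k" "1 \<le> j"
  shows "w \<otimes> ascending k j \<in> reps (j - 1)"
proof -
  have w: "w \<in> carrier W" "\<And>i. 1 \<le> i \<Longrightarrow> i \<le> j \<Longrightarrow> \<not> descent w (s i)"
    using assms by (auto simp: mem_reps)
  have "\<not> descent (w \<otimes> ascending k j) (s i)" if i: "1 \<le> i" "i \<le> j - 1" for i
  proof -
    have S: "s i \<in> S" "s (i + 1) \<in> S" "i + 1 \<le> n" using i assms by auto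
    consider "i + 1 < k" | "k = Suc i" | "k \<le> i" by linarith
    then show ?thesis
    proof cases
      case 1
      then show ?thesis using descent_mult_ascending[of i k j w] w i assms by auto
    next
      case 2
      have "w \<otimes> ascending k j = (w \<otimes> s k) \<otimes> ascending (Suc k) j"
        using 2 i w S assms ascending_first[of k j] by (simp add: m_assoc)
      then have "descent (w \<otimes> ascending k j) (s i) \<longleftrightarrow> descent (w \<otimes> s k) (s i)"
        using descent_mult_ascending[of i "Suc k" j "w \<otimes> s k"] w i assms 2 S by auto
      moreover have "\<not> descent (w \<otimes> s k) (s i)"
      proof
        assume "descent (w \<otimes> s k) (s i)"
        \<comment> \<open>The shorter word \<open>q\<close> can only be empty, so the product of the
          distinct generators \<open>s k\<close> and \<open>s i\<close> would be one.\<close>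
        then have "\<exists>q \<in> lists (s ` {1..j}). length q < length [s k] \<and> word_prod W q = word_prod W [s k] \<otimes> s i"
          using 2 i S by (intro min_coset_reps_descent[OF parabolic_subset[OF assms(1)] assms(2)[unfolded reps_def]]) auto
        then have "s k \<otimes> s i = \<one>" using 2 S by auto
        then have "s k = s i" using 2 S by (metis gen_closed inv_equality inv_gen Suc_eq_plus1)
        then show False using 2 i assms by simp
      qed
      ultimately show ?thesis by simp
    next
      case 3
      \<comment> \<open>With the factors \<open>s i\<close> and \<open>s (i + 1)\<close> isolated,
        the braid relation moves the test from \<open>s i\<close> to \<open>s (i + 1)\<close> and
        makes \<open>s i\<close> cancel with itself.\<close>
      let ?y = "w \<otimes> ascending k (i - 1)" and ?z = "ascending (Suc (Suc i)) j"
      have yz: "?y \<in> carrier W" "?z \<in> carrier W" using i assms w by auto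
      have "ascending k j = ascending k (i - 1) \<otimes> ascending i j"
        using ascending_split[of k "i - 1" j] 3 i assms by simp
      also have "ascending i j = s i \<otimes> (s (i + 1) \<otimes> ?z)"
        using ascending_first[of i j] ascending_first[of "Suc i" j] i assms by simp
      finally have "w \<otimes> ascending k j = (?y \<otimes> s i \<otimes> s (i + 1)) \<otimes> ?z"
        using yz w S i assms by (simp add: m_assoc)
      then have "descent (w \<otimes> ascending k j) (s i) \<longleftrightarrow> descent ((?y \<otimes> s i) \<otimes> s (i + 1)) (s i)"
        using descent_mult_ascending[of i "Suc (Suc i)" j "?y \<otimes> s i \<otimes> s (i + 1)"] yz i assms S by auto
      also have "\<dots> \<longleftrightarrow> descent ((?y \<otimes> s i) \<otimes> s i) (s (i + 1))"
        using yz S i s_braid[of i] by (intro descent_mult_braid) auto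
      also have "(?y \<otimes> s i) \<otimes> s i = ?y"
        using yz(1) S by (simp add: m_assoc gen_square del: ascending_closed)
      also have "descent ?y (s (i + 1)) \<longleftrightarrow> descent w (s (i + 1))"
        using descent_mult_ascending[of "i + 1" k "i - 1" w] w i assms by auto
      finally show ?thesis using w(2)[of "i + 1"] i by simp
    qed
  qed
  then show ?thesis using assms w by (simp add: mem_reps)
qed

text \<open>Cancelling the common tail would make \<open>ascending k (l - 1)\<close> trivial, so
  \<open>s k\<close> would be a product of the generators
  \<open>s (k + 1), ..., s (l - 1)\<close>.\<close>

lemma ascending_inj:
  assumes "1 \<le> k" "k < l" "l \<le> Suc j" "j \<le> n"
  shows "ascending k j \<noteq> ascending l j"
proof
  assume eq: "ascending k j = ascending l j"
  have m: "k \<le> l - 1" "l - 1 \<le> n" "l = Suc (l - 1)" using assms by auto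
  have c: "ascending k (l - 1) \<in> carrier W" "ascending (Suc k) (l - 1) \<in> carrier W" using assms by auto
  have "ascending k j = ascending k (l - 1) \<otimes> ascending l j"
    using ascending_split[of k "l - 1" j] assms m by simp
  then have "ascending k (l - 1) = \<one>" using eq c assms by simp
  then have "s k \<otimes> ascending (Suc k) (l - 1) = \<one>" using ascending_first[OF m(1)] by simp
  then have "inv (ascending (Suc k) (l - 1)) = s k"
    using c assms m by (intro inv_equality) auto
  moreover have "inv (ascending (Suc k) (l - 1)) = word_prod W (rev (map s [Suc k..<Suc (l - 1)]))"
    unfolding ascending_def using word_prod_rev[OF ascending_word[of "Suc k" "l - 1"]] m by simp
  moreover have "word_prod W (rev (map s [Suc k..<Suc (l - 1)])) \<noteq> s k"
    using assms m by (intro not_in_parabolic[of "s ` {Suc k..l - 1}"]) auto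
  ultimately show False by simp
qed

text \<open>Injectivity: \<open>w\<close> and \<open>v\<close> lie in one coset of the larger
  parabolic subgroup, so they agree, and the ascending products are distinct. Surjectivity:
  decompose \<open>v\<close> first by that subgroup and then by
  \<open>parabolic_decomposition\<close>; the remaining factor \<open>q\<close> is trivial by
  uniqueness for \<open>j - 1\<close>.\<close>

lemma bij_reps:
  assumes "1 \<le> j" "j \<le> n"
  shows "bij_betw (\<lambda>(w, k). w \<otimes> ascending k j) (reps j \<times> {1..Suc j}) (reps (j - 1))"
proof (rule bij_betw_imageI)
  note reps_unique = min_coset_reps_unique[OF parabolic_subset, folded reps_def]
  have ascending_parabolic: "\<exists>p \<in> lists (s ` {1..j}). ascending k j = word_prod W p" if "1 \<le> k" for k
    unfolding ascending_def using that by (intro bexI[of _ "map s [k..<Suc j]"]) auto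
  show "inj_on (\<lambda>(w, k). w \<otimes> ascending k j) (reps j \<times> {1..Suc j})"
  proof (rule inj_onI, clarsimp)
    fix w k v l
    assume wv: "w \<in> reps j" "v \<in> reps j" and kl: "Suc 0 \<le> k" "k \<le> Suc j" "Suc 0 \<le> l" "l \<le> Suc j"
      and eq: "w \<otimes> ascending k j = v \<otimes> ascending l j"
    have c: "w \<in> carrier W" "v \<in> carrier W" "ascending k j \<in> carrier W" "ascending l j \<in> carrier W"
      using wv kl assms by (auto simp: mem_reps)
    obtain p q where pq: "p \<in> lists (s ` {1..j})" "ascending k j = word_prod W p"
      "q \<in> lists (s ` {1..j})" "ascending l j = word_prod W q"
      using ascending_parabolic kl by (metis One_nat_def)
    have S: "p \<in> lists S" "q \<in> lists S" using pq lists_subset parabolic_subset assms by blast+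
    have "w \<otimes> word_prod W (p @ rev q) = w \<otimes> ascending k j \<otimes> inv (ascending l j)"
      using S c pq by (simp add: word_prod_append word_prod_rev m_assoc)
    also have "\<dots> = v" using eq c by (simp add: m_assoc)
    finally have v: "w \<otimes> word_prod W (p @ rev q) = v" .
    then have "word_prod W (p @ rev q) = \<one>"
      using reps_unique[OF assms(2) wv(1), of "p @ rev q"] wv pq by auto
    then have wv': "w = v" using v c by simp
    then have "ascending k j = ascending l j" using eq c by simp
    then have "k = l" using ascending_inj[of k l j] ascending_inj[of l k j] kl assms
      by (metis One_nat_def linorder_neqE_nat)
    then show "w = v \<and> k = l" using wv' by simp
  qed
  show "(\<lambda>(w, k). w \<otimes> ascending k j) ` (reps j \<times> {1..Suc j}) = reps (j - 1)"
  proof (intro equalityI subsetI)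
    fix v assume v: "v \<in> reps (j - 1)"
    then have vc: "v \<in> carrier W" using assms by (auto simp: mem_reps)
    obtain w p where w: "w \<in> reps j" "p \<in> lists (s ` {1..j})" "v = w \<otimes> word_prod W p"
      using min_coset_reps_min_length[OF parabolic_subset[OF assms(2)] vc, folded reps_def] by metis
    obtain k q where kq: "k \<in> {1..Suc j}" "q \<in> lists (s ` {1..j - 1})"
      "word_prod W p = ascending k j \<otimes> word_prod W q"
      using parabolic_decomposition[OF assms w(2)] by blast
    have J: "s ` {1..j - 1} \<subseteq> S" using parabolic_subset assms by auto
    have c: "w \<in> carrier W" "ascending k j \<in> carrier W" "q \<in> lists S"
      using w kq assms lists_subset[OF _ J] by (auto simp: mem_reps)
    have "w \<otimes> ascending k j \<in> reps (j - 1)" using reps_mult_ascending w kq assms by simp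
    moreover have "v = (w \<otimes> ascending k j) \<otimes> word_prod W q"
      using w kq c by (simp add: m_assoc)
    ultimately have "word_prod W q = \<one>" using reps_unique[of "j - 1" "w \<otimes> ascending k j" q] kq v assms by auto
    then have "v = w \<otimes> ascending k j" using w kq c by simp
    then show "v \<in> (\<lambda>(w, k). w \<otimes> ascending k j) ` (reps j \<times> {1..Suc j})" using w kq by auto
  qed (use reps_mult_ascending assms in auto)
qed

lemma one_mem_reps: "j \<le> n \<Longrightarrow> \<one> \<in> reps j"
  using not_inverts_one by (auto simp: mem_reps descent_def)

lemma reps_top: "reps n = {\<one>}"
proof -
  have "w = \<one>" if w: "w \<in> reps n" for w
  proof -
    have "w \<in> carrier W" using w by (simp add: mem_reps)
    then obtain u where u: "u \<in> lists (s ` {1..n})" "word_prod W u = w" using word_exists S_eq by metis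
    show ?thesis
      using min_coset_reps_unique[OF parabolic_subset one_mem_reps[unfolded reps_def] u(1)] u(2) w[unfolded reps_def] \<open>w \<in> carrier W\<close> by simp
  qed
  then show ?thesis using one_mem_reps[of n] by blast
qed

text \<open>This tells the sets \<open>reps j\<close> apart and yields the linear independence
  below.\<close>

lemma s_mem_reps_iff:
  assumes "j \<le> n" "1 \<le> i" "i \<le> n"
  shows "s i \<in> reps j \<longleftrightarrow> j < i"
proof
  assume "s i \<in> reps j"
  then show "j < i" using assms descent_gen[of "s i"] by (fastforce simp: mem_reps)
next
  assume "j < i"
  then show "s i \<in> reps j" using assms not_descent_gen[of _ "s i"] by (auto simp: mem_reps)
qed

lemma bij_reps_mult_ascending_far:
  assumes "j + 1 < k" "k \<le> n + 1"
  shows "bij_betw (\<lambda>w. w \<otimes> ascending k n) (reps j) (reps j)"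
proof (rule bij_betw_byWitness[where f' = "\<lambda>w. w \<otimes> inv (ascending k n)"])
  have c: "ascending k n \<in> carrier W" using assms by simp
  show "\<forall>w \<in> reps j. w \<otimes> ascending k n \<otimes> inv (ascending k n) = w"
    "\<forall>w \<in> reps j. w \<otimes> inv (ascending k n) \<otimes> ascending k n = w"
    using c assms by (auto simp: mem_reps m_assoc)
  have d: "descent (w \<otimes> ascending k n) (s i) \<longleftrightarrow> descent w (s i)"
    if "w \<in> carrier W" "i \<in> {1..j}" for w i
    using that assms descent_mult_ascending[of i k n w] by auto
  show "(\<lambda>w. w \<otimes> ascending k n) ` reps j \<subseteq> reps j"
    using d c assms by (auto simp: mem_reps)
  show "(\<lambda>w. w \<otimes> inv (ascending k n)) ` reps j \<subseteq> reps j"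
  proof (intro image_subsetI)
    fix w assume "w \<in> reps j"
    then have w: "w \<in> carrier W" "\<And>i. i \<in> {1..j} \<Longrightarrow> \<not> descent w (s i)"
      using assms by (auto simp: mem_reps)
    have "\<not> descent (w \<otimes> inv (ascending k n)) (s i)" if "i \<in> {1..j}" for i
      using d[of "w \<otimes> inv (ascending k n)" i] w c that by (simp add: m_assoc)
    then show "w \<otimes> inv (ascending k n) \<in> reps j" using w c assms by (simp add: mem_reps)
  qed
qed

text \<open>\<open>reps 0\<close> is the whole group, so this is a right translation; it includes
  \<open>k = 1\<close>, which the previous lemma excludes for \<open>j = 0\<close>.\<close>

lemma bij_reps_zero: "1 \<le> k \<Longrightarrow> bij_betw (\<lambda>w. w \<otimes> ascending k n) (reps 0) (reps 0)"
  by (rule bij_betw_byWitness[where f' = "\<lambda>w. w \<otimes> inv (ascending k n)"])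
    (auto simp: mem_reps m_assoc)

end

section \<open>Evaluation of rational polynomials\<close>

lemma rat_field_simps [simp]:
  "carrier rat_field = UNIV" "\<zero>\<^bsub>rat_field\<^esub> = 0" "\<one>\<^bsub>rat_field\<^esub> = 1"
  "a \<oplus>\<^bsub>rat_field\<^esub> b = a + b" "a \<otimes>\<^bsub>rat_field\<^esub> b = a * b"
  by (simp_all add: ring_of_type_algebra_def)

lemma poly_algebra_simps [simp]:
  "carrier poly_algebra = UNIV" "\<one>\<^bsub>poly_algebra\<^esub> = 1" "p \<otimes>\<^bsub>poly_algebra\<^esub> q = p * q"
  "p \<oplus>\<^bsub>poly_algebra\<^esub> q = p + q" "c \<odot>\<^bsub>poly_algebra\<^esub> p = Polynomial.smult c p"
  by (simp_all add: poly_algebra_def)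

lemma quotient_algebra_simps:
  "carrier (quotient_algebra A I) = a_rcosets\<^bsub>A\<^esub> I"
  "\<one>\<^bsub>quotient_algebra A I\<^esub> = I +>\<^bsub>A\<^esub> \<one>\<^bsub>A\<^esub>"
  "B \<otimes>\<^bsub>quotient_algebra A I\<^esub> C = (\<Union>b\<in>B. \<Union>c\<in>C. I +>\<^bsub>A\<^esub> (b \<otimes>\<^bsub>A\<^esub> c))"
  "B \<oplus>\<^bsub>quotient_algebra A I\<^esub> C = (\<Union>b\<in>B. \<Union>c\<in>C. {b \<oplus>\<^bsub>A\<^esub> c})"
  "r \<odot>\<^bsub>quotient_algebra A I\<^esub> C = (\<Union>c\<in>C. I +>\<^bsub>A\<^esub> (r \<odot>\<^bsub>A\<^esub> c))"
  by (simp_all add: quotient_algebra_def ring.defs module.defs FactRing_def rcoset_mult_def set_add_defs)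

section \<open>Bases of polynomials by degree, falling powers and Stirling numbers\<close>

text \<open>Triangularity: a multiple of the top polynomial cancels the top coefficient, and the
  degree drops.\<close>

lemma poly_sum_degree_basis:
  fixes q :: "nat \<Rightarrow> 'a::field poly"
  assumes "\<And>k. k \<le> n \<Longrightarrow> degree (q k) = k \<and> q k \<noteq> 0" "degree p \<le> n"
  shows "\<exists>a. p = (\<Sum>k\<le>n. smult (a k) (q k))"
  using assms
proof (induction n arbitrary: p)
  case 0
  then obtain c where c: "p = [:c:]" using degree_eq_zeroE by auto
  obtain d where d: "q 0 = [:d:]" using 0(1)[of 0] degree_eq_zeroE by auto
  have "d \<noteq> 0" using 0(1)[of 0] d by auto
  then show ?case using c d by (intro exI[of _ "\<lambda>_. c / d"]) simp
next
  case (Suc n)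
  let ?q = "q (Suc n)"
  define c where "c = coeff p (Suc n) / lead_coeff ?q"
  have q: "degree ?q = Suc n" "?q \<noteq> 0" using Suc.prems(1)[of "Suc n"] by auto
  then have lc: "lead_coeff ?q \<noteq> 0" using leading_coeff_neq_0 by blast
  have "degree (p - smult c ?q) \<le> n"
  proof (rule degree_le, intro allI impI)
    fix i assume i: "n < i"
    show "coeff (p - smult c ?q) i = 0"
    proof (cases "i = Suc n")
      case True
      then show ?thesis using q(1) lc by (simp add: c_def)
    next
      case False
      then show ?thesis using i q Suc.prems(2) by (simp add: coeff_eq_0)
    qed
  qed
  then obtain a where a: "p - smult c ?q = (\<Sum>k\<le>n. smult (a k) (q k))"
    using Suc.IH[of "p - smult c ?q"] Suc.prems(1) by auto
  have "p = (\<Sum>k\<le>Suc n. smult ((a(Suc n := c)) k) (q k))"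
    using a by (simp add: algebra_simps)
  then show ?case by blast
qed

lemma poly_sum_degree_independent:
  fixes q :: "nat \<Rightarrow> 'a::field poly"
  assumes "\<And>k. k \<le> n \<Longrightarrow> degree (q k) = k \<and> q k \<noteq> 0" "(\<Sum>k\<le>n. smult (a k) (q k)) = 0" "k \<le> n"
  shows "a k = 0"
  using assms
proof (induction n arbitrary: k)
  case 0
  then show ?case by auto
next
  case (Suc n)
  have "coeff (\<Sum>k\<le>Suc n. smult (a k) (q k)) (Suc n) = a (Suc n) * lead_coeff (q (Suc n))"
    using Suc.prems(1) by (simp add: coeff_sum coeff_eq_0)
  then have "a (Suc n) * lead_coeff (q (Suc n)) = 0" unfolding Suc.prems(2) by simp
  moreover have "lead_coeff (q (Suc n)) \<noteq> 0"
    using Suc.prems(1)[of "Suc n"] leading_coeff_neq_0 by blast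
  ultimately have "a (Suc n) = 0" by simp
  then show ?case using Suc by (cases "k = Suc n") auto
qed

lemma falling_power_Suc: "falling_power (Suc k) = falling_power k * [:- of_nat k, 1:]"
  by (simp add: falling_power_def mult.commute)

lemma falling_power_0 [simp]: "falling_power 0 = 1"
  by (simp add: falling_power_def)

lemma falling_power_degree: "degree (falling_power k) = k \<and> falling_power k \<noteq> 0"
proof (induction k)
  case (Suc k)
  then have "falling_power (Suc k) \<noteq> 0" by (simp add: falling_power_Suc del: mult_pCons_right)
  then show ?case using Suc by (simp add: falling_power_Suc degree_mult_eq del: mult_pCons_right)
qed simp

lemma monom_eq_sum_falling_power:
  "monom 1 k = (\<Sum>m\<le>k. smult (of_nat (Stirling k m)) (falling_power m))"
proof (induction k)
  case (Suc k)
  let ?X = "[:0, 1::rat:]"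
  have X: "falling_power m * ?X = falling_power (Suc m) + smult (of_nat m) (falling_power m)" for m
    by (simp add: falling_power_Suc algebra_simps flip: smult_add_left)
  have "monom 1 (Suc k) = monom (1::rat) k * ?X" by (simp add: monom_Suc)
  also have "\<dots> = (\<Sum>m\<le>k. smult (of_nat (Stirling k m)) (falling_power m * ?X))"
    unfolding Suc by (simp only: sum_distrib_right mult_smult_left)
  also have "\<dots> = (\<Sum>m\<le>k. smult (of_nat (Stirling k m)) (falling_power (Suc m))) +
      (\<Sum>m\<le>k. smult (of_nat (m * Stirling k m)) (falling_power m))"
    unfolding X by (simp add: smult_add_right sum.distrib mult.commute)
  \<comment> \<open>The added term has \<open>Stirling k (Suc k) = 0\<close>, and the term at
    \<open>m = 0\<close> has the factor \<open>m\<close>; so the index can be shifted to match the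
    recurrence.\<close>
  also have "(\<Sum>m\<le>k. smult (of_nat (m * Stirling k m)) (falling_power m)) =
      (\<Sum>m\<le>Suc k. smult (of_nat (m * Stirling k m)) (falling_power m))"
    by simp
  also have "\<dots> = (\<Sum>m\<le>k. smult (of_nat (Suc m * Stirling k (Suc m))) (falling_power (Suc m)))"
    by (subst sum.atMost_Suc_shift) simp
  also have "(\<Sum>m\<le>k. smult (of_nat (Stirling k m)) (falling_power (Suc m))) + \<dots> =
      (\<Sum>m\<le>k. smult (of_nat (Stirling (Suc k) (Suc m))) (falling_power (Suc m)))"
    by (simp add: smult_add_left algebra_simps flip: sum.distrib)
  also have "\<dots> = (\<Sum>m\<le>Suc k. smult (of_nat (Stirling (Suc k) m)) (falling_power m))"
    by (subst sum.atMost_Suc_shift) simp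
  finally show ?case .
qed simp

lemma falling_power_eq_sum_monom:
  "falling_power k = (\<Sum>m\<le>k. smult ((-1) ^ (k - m) * of_nat (stirling k m)) (monom 1 m))"
proof (induction k)
  case (Suc k)
  let ?c = "\<lambda>k m. (-1) ^ (k - m) * rat_of_nat (stirling k m)"
  have "falling_power (Suc k) = (\<Sum>m\<le>k. smult (?c k m) (monom 1 m * [:- of_nat k, 1:]))"
    unfolding falling_power_Suc Suc by (simp only: sum_distrib_right mult_smult_left)
  also have "\<dots> = (\<Sum>m\<le>k. monom (?c k m) (Suc m)) + (\<Sum>m\<le>k. monom (- of_nat k * ?c k m) m)"
  proof -
    have "[:- of_nat k, 1::rat:] = monom 1 1 + monom (- of_nat k) 0"
      by (simp add: monom_altdef)
    then show ?thesis
      unfolding sum.distrib[symmetric]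
      by (simp only: distrib_left mult_monom smult_add_right smult_monom) (simp add: mult.commute)
  qed
  also have "(\<Sum>m\<le>k. monom (- of_nat k * ?c k m) m) = (\<Sum>m\<le>Suc k. monom (- of_nat k * ?c k m) m)"
    by simp
  also have "\<dots> = (\<Sum>m\<le>k. monom (- of_nat k * ?c k (Suc m)) (Suc m))"
    by (subst sum.atMost_Suc_shift) (cases k; simp)
  also have "(\<Sum>m\<le>k. monom (?c k m) (Suc m)) + \<dots> = (\<Sum>m\<le>k. monom (?c (Suc k) (Suc m)) (Suc m))"
    unfolding sum.distrib[symmetric] add_monom
  proof (intro sum.cong[OF HOL.refl] arg_cong2[of _ _ _ _ monom] HOL.refl)
    fix m assume m: "m \<in> {..k}"
    show "?c k m + - of_nat k * ?c k (Suc m) = ?c (Suc k) (Suc m)"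
    \<comment> \<open>Subtraction is truncated: \<open>k - m\<close> is the successor of
      \<open>k - Suc m\<close> except for \<open>m = k\<close>, where
      \<open>stirling k (Suc k)\<close> vanishes.\<close>
    proof (cases "m = k")
      case False
      then have "k - m = Suc (k - Suc m)" using m by auto
      then show ?thesis by (simp add: algebra_simps)
    qed simp
  qed
  also have "\<dots> = (\<Sum>m\<le>Suc k. monom (?c (Suc k) m) m)"
    by (subst sum.atMost_Suc_shift) simp
  finally show ?case by (simp add: smult_monom)
qed simp

section \<open>Evaluation of polynomials in an associative unital algebra\<close>

locale rat_algebra = Module.module rat_field A + A?: ring A for A :: "(rat, 'a) module" (structure) +
  assumes smult_mult_left:
      "\<lbrakk>x \<in> carrier A; y \<in> carrier A\<rbrakk> \<Longrightarrow> (c \<odot> x) \<otimes> y = c \<odot> (x \<otimes> y)"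
    and smult_mult_right:
      "\<lbrakk>x \<in> carrier A; y \<in> carrier A\<rbrakk> \<Longrightarrow> x \<otimes> (c \<odot> y) = c \<odot> (x \<otimes> y)"
begin

lemma smult_closed' [simp]: "x \<in> carrier A \<Longrightarrow> c \<odot> x \<in> carrier A"
  using smult_closed by simp

lemma smult_add_left': "x \<in> carrier A \<Longrightarrow> (b + c) \<odot> x = b \<odot> x \<oplus> c \<odot> x"
  using smult_l_distr[of b c x] by simp

lemma smult_add_right': "x \<in> carrier A \<Longrightarrow> y \<in> carrier A \<Longrightarrow> c \<odot> (x \<oplus> y) = c \<odot> x \<oplus> c \<odot> y"
  using smult_r_distr[of c x y] by simp

lemma smult_smult': "x \<in> carrier A \<Longrightarrow> (b * c) \<odot> x = b \<odot> (c \<odot> x)"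
  using smult_assoc1[of b c x] by simp

lemma smult_zero_left' [simp]: "x \<in> carrier A \<Longrightarrow> 0 \<odot> x = \<zero>"
  using smult_l_null[of x] by simp

lemma smult_zero_right' [simp]: "c \<odot> \<zero> = \<zero>"
  using smult_r_null[of c] by simp

lemma smult_one' [simp]: "x \<in> carrier A \<Longrightarrow> 1 \<odot> x = x"
  using smult_one[of x] by simp

text \<open>Horner's scheme, with \<open>x\<close> as right factor to match the identities for right
  multiplication by \<open>x\<close> in the overview.\<close>

definition poly_at :: "'a \<Rightarrow> rat poly \<Rightarrow> 'a"
  where "poly_at x p = fold_coeffs (\<lambda>c y. c \<odot> \<one> \<oplus> y \<otimes> x) p \<zero>"

context
  fixes x assumes x [simp]: "x \<in> carrier A"
begin

lemma poly_at_0 [simp]: "poly_at x 0 = \<zero>"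
  by (simp add: poly_at_def)

lemma poly_at_pCons [simp]: "poly_at x (pCons c p) = c \<odot> \<one> \<oplus> poly_at x p \<otimes> x"
proof (cases "c = 0 \<and> p = 0")
  case False
  then show ?thesis unfolding poly_at_def by (cases "c = 0") auto
qed simp

lemma poly_at_closed [simp]: "poly_at x p \<in> carrier A"
  by (induction p) auto

lemma poly_at_1 [simp]: "poly_at x 1 = \<one>"
  by (simp add: one_pCons)

lemma poly_at_X [simp]: "poly_at x [:0, 1:] = x"
  by simp

lemma poly_at_add: "poly_at x (p + q) = poly_at x p \<oplus> poly_at x q"
proof (induction p q rule: poly_induct2)
  case (pCons b p c q)
  then show ?case by (simp add: smult_add_left' A.l_distr M.add.m_ac)
qed simp

lemma poly_at_smult: "poly_at x (smult c p) = c \<odot> poly_at x p"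
  by (induction p) (simp_all add: smult_add_right' smult_smult' smult_mult_left)

lemma poly_at_minus: "poly_at x (- p) = \<ominus> poly_at x p"
proof -
  have "poly_at x (- p) \<oplus> poly_at x p = \<zero>" by (simp flip: poly_at_add)
  then show ?thesis by (simp add: M.minus_equality)
qed

text \<open>This takes the place of commutativity of the algebra in the proof that evaluation is
  multiplicative.\<close>

lemma poly_at_commute: "x \<otimes> poly_at x p = poly_at x p \<otimes> x"
proof (induction p)
  case (pCons c p)
  then show ?case
    by (simp add: A.l_distr A.r_distr smult_mult_left smult_mult_right flip: A.m_assoc)
qed simp

lemma poly_at_mult: "poly_at x (p * q) = poly_at x p \<otimes> poly_at x q"
proof (induction p)
  case (pCons c p)
  have "poly_at x (pCons c p * q) = c \<odot> poly_at x q \<oplus> poly_at x p \<otimes> poly_at x q \<otimes> x"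
    using pCons by (simp add: poly_at_add poly_at_smult)
  also have "poly_at x p \<otimes> poly_at x q \<otimes> x = poly_at x p \<otimes> x \<otimes> poly_at x q"
    by (simp add: A.m_assoc poly_at_commute)
  finally show ?case by (simp add: A.l_distr smult_mult_left)
qed simp

lemma poly_at_monom: "poly_at x (Polynomial.monom 1 k) = x [^] k"
  by (induction k) (simp_all add: Polynomial.monom_Suc Polynomial.monom_0)

lemma poly_at_sum:
  assumes "finite I"
  shows "poly_at x (\<Sum>i\<in>I. smult (a i) (q i)) = (\<Oplus>i\<in>I. a i \<odot> poly_at x (q i))"
  using assms by induction (simp_all add: poly_at_add poly_at_smult M.finsum_insert Pi_def)

lemma carrier_adjoin: "carrier (adjoin A x) = range (poly_at x)"
proof
  have "subring (range (poly_at x)) A"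
  proof (rule A.subringI)
    show "\<one> \<in> range (poly_at x)" by (metis poly_at_1 rangeI)
    show "\<ominus> h \<in> range (poly_at x)" if "h \<in> range (poly_at x)" for h
      using that by (auto simp flip: poly_at_minus)
    show "g \<otimes> h \<in> range (poly_at x)" if "g \<in> range (poly_at x)" "h \<in> range (poly_at x)" for g h
      using that by (auto simp flip: poly_at_mult)
    show "g \<oplus> h \<in> range (poly_at x)" if "g \<in> range (poly_at x)" "h \<in> range (poly_at x)" for g h
      using that by (auto simp flip: poly_at_add)
  qed auto
  moreover have "c \<odot> h \<in> range (poly_at x)" if "h \<in> range (poly_at x)" for c h
    using that by (auto simp flip: poly_at_smult)
  moreover have "x \<in> range (poly_at x)" by (metis poly_at_X rangeI)
  ultimately show "carrier (adjoin A x) \<subseteq> range (poly_at x)" by (auto simp: adjoin_def)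
  have "poly_at x p \<in> B" if B: "subring B A" "\<And>c b. b \<in> B \<Longrightarrow> c \<odot> b \<in> B" "x \<in> B" for B p
    using B(2,3) subringE[OF B(1)] by (induction p) auto
  then show "range (poly_at x) \<subseteq> carrier (adjoin A x)" by (auto simp: adjoin_def)
qed

lemma adjoin_simps [simp]:
  "\<zero>\<^bsub>adjoin A x\<^esub> = \<zero>" "\<one>\<^bsub>adjoin A x\<^esub> = \<one>" "g \<oplus>\<^bsub>adjoin A x\<^esub> h = g \<oplus> h"
  "g \<otimes>\<^bsub>adjoin A x\<^esub> h = g \<otimes> h" "c \<odot>\<^bsub>adjoin A x\<^esub> h = c \<odot> h"
  by (simp_all add: adjoin_def)

lemma vectorspace_adjoin: "vectorspace rat_field (adjoin A x)"
proof -
  have "submodule rat_field (range (poly_at x)) A"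
  proof (unfold_locales, goal_cases)
    case 3
    show ?case by (metis poly_at_0 rangeI)
  qed (auto simp flip: poly_at_add poly_at_smult)
  then have "Module.module rat_field (A\<lparr>carrier := range (poly_at x)\<rparr>)" by (rule submodule_is_module)
  moreover have "A\<lparr>carrier := range (poly_at x)\<rparr> = adjoin A x"
    using carrier_adjoin by (simp add: adjoin_def)
  ultimately show ?thesis using field_from_type_algebra unfolding vectorspace_def by auto
qed

lemma poly_at_sum_adjoin:
  assumes "finite I"
  shows "poly_at x (\<Sum>i\<in>I. smult (a i) (q i)) = (\<Oplus>\<^bsub>adjoin A x\<^esub>i\<in>I. a i \<odot> poly_at x (q i))"
proof -
  interpret E: vectorspace rat_field "adjoin A x" by (rule vectorspace_adjoin)
  have cl: "c \<odot> poly_at x p \<in> carrier (adjoin A x)" for c p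
    unfolding carrier_adjoin by (simp flip: poly_at_smult)
  show ?thesis
    using assms
  proof induction
    case (insert i I)
    then show ?case using cl by (simp add: poly_at_add poly_at_smult E.finsum_insert Pi_def)
  qed simp
qed

section \<open>Bases and quotient presentation from a known kernel\<close>

context
  fixes f :: "rat poly" and n :: nat
  assumes degree_f: "Polynomial.degree f = Suc n"
    and kernel: "\<And>p. poly_at x p = \<zero> \<longleftrightarrow> f dvd p"
begin

lemma poly_at_eq_iff: "poly_at x p = poly_at x q \<longleftrightarrow> f dvd p - q"
proof -
  have "poly_at x (p - q) = poly_at x p \<ominus> poly_at x q"
    using poly_at_add[of p "- q"] by (simp add: poly_at_minus M.minus_eq)
  then show ?thesis using kernel[of "p - q"] by simp
qed

lemma poly_at_eq_zero: "Polynomial.degree p \<le> n \<Longrightarrow> poly_at x p = \<zero> \<Longrightarrow> p = 0"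
  using kernel[of p] dvd_imp_degree_le[of f p] degree_f by (cases "p = 0") auto

text \<open>Each residue class modulo \<open>f\<close> has a unique representative of degree at most
  \<open>n\<close>, and \<open>q 0, ..., q n\<close> form a basis of the space of these
  representatives.\<close>

lemma family_basis_adjoin:
  assumes q: "\<And>k. k \<le> n \<Longrightarrow> Polynomial.degree (q k) = k \<and> q k \<noteq> 0"
  shows "family_basis (adjoin A x) {0..n} (\<lambda>k. poly_at x (q k))"
proof -
  let ?b = "\<lambda>k. poly_at x (q k)" and ?E = "adjoin A x"
  interpret E: vectorspace rat_field ?E by (rule vectorspace_adjoin)
  have inj: "inj_on ?b {0..n}"
  proof (rule inj_onI)
    fix i j assume ij: "i \<in> {0..n}" "j \<in> {0..n}" "?b i = ?b j"
    then have "poly_at x (q i - q j) = \<zero>" unfolding kernel poly_at_eq_iff[symmetric] by simp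
    moreover have "Polynomial.degree (q i - q j) \<le> n" using ij q by (intro degree_diff_le) auto
    ultimately have "q i = q j" using poly_at_eq_zero[of "q i - q j"] by simp
    then show "i = j" using ij q by (metis atLeastAtMost_iff)
  qed
  have b: "?b ` {0..n} \<subseteq> carrier ?E" by (auto simp: carrier_adjoin)
  \<comment> \<open>Coefficients in \<open>lincomb\<close> are indexed by vectors; injectivity of
    \<open>?b\<close> allows summing over exponents instead.\<close>
  have lincomb: "E.lincomb a (?b ` {0..n}) = poly_at x (\<Sum>k\<le>n. smult (a (?b k)) (q k))" for a
  proof -
    have "E.lincomb a (?b ` {0..n}) = (\<Oplus>\<^bsub>?E\<^esub>v\<in>?b ` {0..n}. a v \<odot>\<^bsub>?E\<^esub> v)"
      by (simp add: E.lincomb_def)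
    also have "\<dots> = (\<Oplus>\<^bsub>?E\<^esub>k\<in>{0..n}. a (?b k) \<odot>\<^bsub>?E\<^esub> ?b k)"
      using b by (intro E.finsum_reindex inj) (auto intro!: E.smult_closed simp del: adjoin_simps)
    also have "\<dots> = poly_at x (\<Sum>k\<in>{0..n}. smult (a (?b k)) (q k))"
      by (simp add: poly_at_sum_adjoin)
    finally show ?thesis by (simp add: atLeast0AtMost)
  qed
  have "\<not> E.lin_dep (?b ` {0..n})"
  proof (rule E.finite_lin_indpt2[OF _ b])
    fix a assume "E.lincomb a (?b ` {0..n}) = \<zero>\<^bsub>?E\<^esub>"
    then have "poly_at x (\<Sum>k\<le>n. smult (a (?b k)) (q k)) = \<zero>" by (simp add: lincomb)
    moreover have "Polynomial.degree (\<Sum>k\<le>n. smult (a (?b k)) (q k)) \<le> n"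
      using q by (intro degree_sum_le) (auto intro: order_trans[OF degree_smult_le])
    ultimately have "(\<Sum>k\<le>n. smult (a (?b k)) (q k)) = 0" by (rule poly_at_eq_zero[rotated])
    then have "a (?b k) = 0" if "k \<le> n" for k
      using poly_sum_degree_independent[of n q "\<lambda>k. a (?b k)"] q that by blast
    then show "\<forall>v \<in> ?b ` {0..n}. a v = \<zero>\<^bsub>rat_field\<^esub>" by auto
  qed simp
  moreover have "E.span (?b ` {0..n}) = carrier ?E"
  proof
    show "E.span (?b ` {0..n}) \<subseteq> carrier ?E"
      by (subst E.finite_span[OF _ b]) (auto simp: lincomb carrier_adjoin)
    show "carrier ?E \<subseteq> E.span (?b ` {0..n})"
    proof
      fix y assume "y \<in> carrier ?E"
      then obtain p where p: "y = poly_at x p" by (auto simp: carrier_adjoin)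
      have "f \<noteq> 0" using degree_f by auto
      then have "Polynomial.degree (p mod f) \<le> n"
        using degree_mod_less[of f p] degree_f by auto
      then obtain a where a: "p mod f = (\<Sum>k\<le>n. smult (a k) (q k))"
        using poly_sum_degree_basis[of n q "p mod f"] q by blast
      have "y = poly_at x (p mod f)" unfolding p poly_at_eq_iff by (simp add: minus_mod_eq_mult_div)
      \<comment> \<open>The coefficients are carried back from exponents to vectors by the inverse
        of \<open>?b\<close>.\<close>
      also have "\<dots> = poly_at x (\<Sum>k\<le>n. smult (a (the_inv_into {0..n} ?b (?b k))) (q k))"
        unfolding a by (intro arg_cong[of _ _ "poly_at x"] sum.cong[OF HOL.refl])
          (subst the_inv_into_f_f[OF inj], auto)
      also have "\<dots> = E.lincomb (\<lambda>v. a (the_inv_into {0..n} ?b v)) (?b ` {0..n})"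
        by (simp add: lincomb)
      finally show "y \<in> E.span (?b ` {0..n})" by (subst E.finite_span[OF _ b]) auto
    qed
  qed
  ultimately show ?thesis using inj b unfolding family_basis_def E.basis_def by blast
qed

text \<open>The first isomorphism theorem, read from the image to the quotient: \<open>K\<close>
  sends a value to its fibre under evaluation, which is a coset of the kernel.\<close>

lemma adjoin_isomorphic: "algebra_isomorphic (adjoin A x) (quotient_algebra poly_algebra (PIdl\<^bsub>poly_algebra\<^esub> f))"
proof -
  let ?I = "PIdl\<^bsub>poly_algebra\<^esub> f"
  let ?Q = "quotient_algebra poly_algebra ?I"
  define K where "K y = {p. poly_at x p = y}" for y
  have I: "?I = {p. f dvd p}"
    by (auto simp: cgenideal_def dvd_def mult.commute)
  have coset: "?I +>\<^bsub>poly_algebra\<^esub> p = K (poly_at x p)" for p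
  proof -
    have "?I +>\<^bsub>poly_algebra\<^esub> p = {h + p | h. f dvd h}"
      by (auto simp: a_r_coset_def' I)
    also have "\<dots> = K (poly_at x p)"
      unfolding K_def poly_at_eq_iff by (auto, metis diff_add_cancel)
    finally show ?thesis .
  qed
  have E: "carrier (adjoin A x) = range (poly_at x)" by (rule carrier_adjoin)
  have carrier_Q: "carrier ?Q = K ` range (poly_at x)"
    by (auto simp: quotient_algebra_simps A_RCOSETS_def' coset)
  have mult: "K (poly_at x p) \<otimes>\<^bsub>?Q\<^esub> K (poly_at x q) = K (poly_at x p \<otimes> poly_at x q)" for p q
    unfolding quotient_algebra_simps poly_algebra_simps coset poly_at_mult by (auto simp: K_def)
  have add: "K (poly_at x p) \<oplus>\<^bsub>?Q\<^esub> K (poly_at x q) = K (poly_at x p \<oplus> poly_at x q)" for p q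
  proof -
    \<comment> \<open>Addition of cosets is the sum of sets, so every \<open>r\<close> in the target
      fibre has to be split into members of the two fibres; multiplication is a union of cosets and
      needs no such splitting.\<close>
    have "\<exists>a. poly_at x a = poly_at x p \<and> (\<exists>b. poly_at x b = poly_at x q \<and> r = a + b)"
      if "poly_at x r = poly_at x p \<oplus> poly_at x q" for r
    proof (intro exI conjI)
      show "r = p + (r - p)" by simp
      have "poly_at x p \<oplus> poly_at x (r - p) = poly_at x p \<oplus> poly_at x q"
        using that by (simp flip: poly_at_add)
      then show "poly_at x (r - p) = poly_at x q" by simp
    qed simp
    then show ?thesis
      unfolding quotient_algebra_simps poly_algebra_simps by (auto simp: K_def poly_at_add)
  qed
  have smult: "c \<odot>\<^bsub>?Q\<^esub> K (poly_at x p) = K (c \<odot> poly_at x p)" for c p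
    unfolding quotient_algebra_simps poly_algebra_simps coset poly_at_smult by (auto simp: K_def)
  have "K \<in> ring_hom (adjoin A x) ?Q"
  proof (rule ring_hom_memI)
    show "K \<one>\<^bsub>adjoin A x\<^esub> = \<one>\<^bsub>?Q\<^esub>"
      by (simp add: quotient_algebra_simps coset)
  qed (auto simp: E carrier_Q mult add)
  moreover have "bij_betw K (carrier (adjoin A x)) (carrier ?Q)"
    unfolding E carrier_Q by (intro bij_betw_imageI inj_onI) (auto simp: K_def)
  moreover have "K \<in> LinearCombinations.module_hom rat_field (adjoin A x) ?Q"
    unfolding LinearCombinations.module_hom_def by (auto simp: E carrier_Q add smult)
  ultimately show ?thesis unfolding algebra_isomorphic_def ring_iso_def by blast
qed

end
end
end

lemma family_basis_reindex:
  assumes "family_basis V I b" "bij_betw h J I"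
  shows "family_basis V J (\<lambda>j. b (h j))"
proof -
  have "inj_on (\<lambda>j. b (h j)) J"
    using assms comp_inj_on[of h J b] by (auto simp: family_basis_def bij_betw_def comp_def)
  moreover have "(\<lambda>j. b (h j)) ` J = b ` I"
    using assms(2) by (auto simp: bij_betw_def)
  ultimately show ?thesis using assms(1) by (simp add: family_basis_def)
qed

section \<open>The group algebra\<close>

lemma finsum_group_algebra:
  assumes "abelian_monoid (group_algebra G)" "finite I" "f \<in> I \<rightarrow> carrier (group_algebra G)"
  shows "finsum (group_algebra G) f I = sum f I"
proof -
  interpret abelian_monoid "group_algebra G" by fact
  show ?thesis
    using assms(2,3)
  proof induction
    case empty
    then show ?case by (simp only: finsum_empty) (simp add: group_algebra_def)
  next
    case (insert i I)
    then have "finsum (group_algebra G) f (insert i I) = f i \<oplus>\<^bsub>group_algebra G\<^esub> finsum (group_algebra G) f I"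
      by (intro finsum_insert) auto
    then show ?case using insert by (simp add: group_algebra_def)
  qed
qed

lemma lookup_map_scale: "Poly_Mapping.lookup (Poly_Mapping.map ((*) (c::rat)) f) a = c * Poly_Mapping.lookup f a"
  by (simp add: Poly_Mapping.map.rep_eq when_def)

lemma group_algebra_simps [simp]:
  "f \<in> carrier (group_algebra G) \<longleftrightarrow> Poly_Mapping.keys f \<subseteq> carrier G"
  "\<one>\<^bsub>group_algebra G\<^esub> = Poly_Mapping.single \<one>\<^bsub>G\<^esub> 1" "\<zero>\<^bsub>group_algebra G\<^esub> = 0"
  "f \<oplus>\<^bsub>group_algebra G\<^esub> h = f + h" "c \<odot>\<^bsub>group_algebra G\<^esub> f = Poly_Mapping.map ((*) c) f"
  by (simp_all add: group_algebra_def)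

abbreviation conv :: "('g, 'm) monoid_scheme \<Rightarrow> ('g \<Rightarrow>\<^sub>0 rat) \<Rightarrow> ('g \<Rightarrow>\<^sub>0 rat) \<Rightarrow> ('g \<Rightarrow>\<^sub>0 rat)"
    (infixl "\<star>\<index>" 70)
  where "f \<star>\<^bsub>G\<^esub> h \<equiv> f \<otimes>\<^bsub>group_algebra G\<^esub> h"

abbreviation scale :: "rat \<Rightarrow> ('g \<Rightarrow>\<^sub>0 rat) \<Rightarrow> ('g \<Rightarrow>\<^sub>0 rat)"
  where "scale c \<equiv> Poly_Mapping.map ((*) c)"

context group
begin

section \<open>The algebra axioms for convolution\<close>

text \<open>Indices outside the supports contribute zero; over common index sets the distributive
  laws can be checked termwise.\<close>

lemma conv_superset:
  assumes "finite A" "finite B" "Poly_Mapping.keys f \<subseteq> A" "Poly_Mapping.keys h \<subseteq> B"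
  shows "f \<star> h = (\<Sum>a\<in>A. \<Sum>b\<in>B. Poly_Mapping.single (a \<otimes> b) (Poly_Mapping.lookup f a * Poly_Mapping.lookup h b))"
proof -
  have "f \<star> h = (\<Sum>a\<in>Poly_Mapping.keys f. \<Sum>b\<in>Poly_Mapping.keys h. Poly_Mapping.single (a \<otimes> b) (Poly_Mapping.lookup f a * Poly_Mapping.lookup h b))"
    by (simp add: group_algebra_def)
  also have "\<dots> = (\<Sum>a\<in>Poly_Mapping.keys f. \<Sum>b\<in>B. Poly_Mapping.single (a \<otimes> b) (Poly_Mapping.lookup f a * Poly_Mapping.lookup h b))"
    using assms by (intro sum.cong HOL.refl sum.mono_neutral_left) (auto simp: in_keys_iff)
  also have "\<dots> = (\<Sum>a\<in>A. \<Sum>b\<in>B. Poly_Mapping.single (a \<otimes> b) (Poly_Mapping.lookup f a * Poly_Mapping.lookup h b))"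
    using assms by (intro sum.mono_neutral_left) (auto simp: in_keys_iff)
  finally show ?thesis .
qed

lemma conv_add_left: "(f + g) \<star> h = f \<star> h + g \<star> h"
  using conv_superset[of "Poly_Mapping.keys f \<union> Poly_Mapping.keys g" "Poly_Mapping.keys h" f h] conv_superset[of "Poly_Mapping.keys f \<union> Poly_Mapping.keys g" "Poly_Mapping.keys h" g h]
    conv_superset[of "Poly_Mapping.keys f \<union> Poly_Mapping.keys g" "Poly_Mapping.keys h" "f + g" h] keys_add[of f g]
  by (simp add: lookup_add distrib_right single_add sum.distrib)

lemma conv_add_right: "f \<star> (g + h) = f \<star> g + f \<star> h"
  using conv_superset[of "Poly_Mapping.keys f" "Poly_Mapping.keys g \<union> Poly_Mapping.keys h" f g] conv_superset[of "Poly_Mapping.keys f" "Poly_Mapping.keys g \<union> Poly_Mapping.keys h" f h]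
    conv_superset[of "Poly_Mapping.keys f" "Poly_Mapping.keys g \<union> Poly_Mapping.keys h" f "g + h"] keys_add[of g h]
  by (simp add: lookup_add distrib_left single_add sum.distrib)

lemma conv_zero [simp]: "0 \<star> f = 0" "f \<star> 0 = 0"
  by (simp_all add: group_algebra_def)

lemma conv_single [simp]:
  "Poly_Mapping.single a c \<star> Poly_Mapping.single b d = Poly_Mapping.single (a \<otimes> b) (c * d)"
  using conv_superset[of "{a}" "{b}" "Poly_Mapping.single a c" "Poly_Mapping.single b d"] by simp

lemma conv_sum_left: "sum f I \<star> h = (\<Sum>i\<in>I. f i \<star> h)"
  by (induction I rule: infinite_finite_induct) (simp_all add: conv_add_left)

lemma conv_sum_right: "h \<star> sum f I = (\<Sum>i\<in>I. h \<star> f i)"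
  by (induction I rule: infinite_finite_induct) (simp_all add: conv_add_right)

lemma scale_add: "scale c (f + h) = scale c f + scale c h"
  by (rule poly_mapping_eqI) (simp add: lookup_map_scale lookup_add distrib_left)

lemma scale_zero [simp]: "scale c 0 = 0"
  by (rule poly_mapping_eqI) (simp add: lookup_map_scale)

text \<open>A finitely supported function is a sum of \<open>single\<close> terms, which reduces
  linear identities to group elements.\<close>

lemma group_algebra_induct [consumes 1, case_names zero add]:
  fixes f :: "'a \<Rightarrow>\<^sub>0 rat"
  assumes "Poly_Mapping.keys f \<subseteq> carrier G" "P 0"
    and "\<And>a c f. \<lbrakk>a \<in> carrier G; Poly_Mapping.keys f \<subseteq> carrier G; P f\<rbrakk> \<Longrightarrow> P (Poly_Mapping.single a c + f)"
  shows "P f"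
proof -
  let ?g = "\<lambda>A. \<Sum>a\<in>A. Poly_Mapping.single a (Poly_Mapping.lookup f a)"
  have lookup: "Poly_Mapping.lookup (?g A) b = (if b \<in> A then Poly_Mapping.lookup f b else 0)" if "finite A" for A b
    using that by (simp add: lookup_sum lookup_single when_def)
  have "P (?g A)" if "finite A" "A \<subseteq> carrier G" for A
    using that
  proof induction
    case (insert a A)
    have "Poly_Mapping.keys (?g A) \<subseteq> A" using lookup[OF insert(1)] by (auto simp: in_keys_iff split: if_splits)
    then show ?case using insert by (auto intro!: assms(3))
  qed (simp add: assms)
  moreover have "?g (Poly_Mapping.keys f) = f"
    by (rule poly_mapping_eqI) (simp add: lookup in_keys_iff)
  ultimately show ?thesis using assms(1) by (metis finite_keys)
qed

lemma keys_add_subset: "Poly_Mapping.keys f \<subseteq> A \<Longrightarrow> Poly_Mapping.keys h \<subseteq> A \<Longrightarrow> Poly_Mapping.keys (f + h) \<subseteq> A"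
  using keys_add[of f h] by blast

lemma conv_single_closed:
  assumes "Poly_Mapping.keys h \<subseteq> carrier G" "a \<in> carrier G"
  shows "Poly_Mapping.keys (Poly_Mapping.single a c \<star> h) \<subseteq> carrier G"
  using assms(1)
  by (induction rule: group_algebra_induct)
    (use assms(2) in \<open>simp_all add: conv_add_right keys_add_subset\<close>)

lemma conv_closed:
  assumes "Poly_Mapping.keys f \<subseteq> carrier G" "Poly_Mapping.keys h \<subseteq> carrier G"
  shows "Poly_Mapping.keys (f \<star> h) \<subseteq> carrier G"
  using assms(1)
  by (induction rule: group_algebra_induct)
    (simp_all add: conv_add_left keys_add_subset conv_single_closed assms(2))

lemma conv_assoc:
  assumes "Poly_Mapping.keys f \<subseteq> carrier G" "Poly_Mapping.keys g \<subseteq> carrier G" "Poly_Mapping.keys h \<subseteq> carrier G"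
  shows "f \<star> g \<star> h = f \<star> (g \<star> h)"
proof -
  have 1: "Poly_Mapping.single a c \<star> Poly_Mapping.single b d \<star> h =
      Poly_Mapping.single a c \<star> (Poly_Mapping.single b d \<star> h)"
    if "a \<in> carrier G" "b \<in> carrier G" for a b c d
    using assms(3)
    by (induction rule: group_algebra_induct) (use that in \<open>simp_all add: conv_add_right m_assoc mult.assoc\<close>)
  have 2: "Poly_Mapping.single a c \<star> g \<star> h = Poly_Mapping.single a c \<star> (g \<star> h)"
    if "a \<in> carrier G" for a c
    using assms(2)
    by (induction rule: group_algebra_induct) (use that 1 in \<open>simp_all add: conv_add_right conv_add_left del: conv_single\<close>)
  show ?thesis
    using assms(1) by (induction rule: group_algebra_induct) (use 2 in \<open>simp_all add: conv_add_left del: conv_single\<close>)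
qed

lemma conv_one_left: "Poly_Mapping.keys f \<subseteq> carrier G \<Longrightarrow> Poly_Mapping.single \<one> 1 \<star> f = f"
  by (induction rule: group_algebra_induct) (simp_all add: conv_add_right)

lemma conv_one_right: "Poly_Mapping.keys f \<subseteq> carrier G \<Longrightarrow> f \<star> Poly_Mapping.single \<one> 1 = f"
  by (induction rule: group_algebra_induct) (simp_all add: conv_add_left)

lemma keys_scale: "Poly_Mapping.keys (scale c f) \<subseteq> Poly_Mapping.keys f"
  by (auto simp: in_keys_iff lookup_map_scale)

lemma scale_conv_single:
  assumes "Poly_Mapping.keys h \<subseteq> carrier G"
  shows "scale c (Poly_Mapping.single a d \<star> h) = Poly_Mapping.single a (c * d) \<star> h"
    "Poly_Mapping.single a d \<star> scale c h = Poly_Mapping.single a (c * d) \<star> h"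
  using assms
  by (induction rule: group_algebra_induct) (simp_all add: conv_add_right scale_add mult_ac)

lemma scale_conv:
  assumes "Poly_Mapping.keys f \<subseteq> carrier G" "Poly_Mapping.keys h \<subseteq> carrier G"
  shows "scale c f \<star> h = scale c (f \<star> h)" "f \<star> scale c h = scale c (f \<star> h)"
  using assms(1)
  by (induction rule: group_algebra_induct)
    (use assms(2) scale_conv_single(1)[OF assms(2)] scale_conv_single(2)[OF assms(2)] in \<open>simp_all add: conv_add_left scale_add del: conv_single\<close>)

lemma rat_algebra_group_algebra: "rat_algebra (group_algebra G)"
proof -
  have ab: "abelian_group (group_algebra G)"
  proof (rule abelian_groupI)
    fix f assume "f \<in> carrier (group_algebra G)"
    then show "\<exists>h \<in> carrier (group_algebra G). h \<oplus>\<^bsub>group_algebra G\<^esub> f = \<zero>\<^bsub>group_algebra G\<^esub>"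
      by (intro bexI[of _ "- f"]) (auto simp: in_keys_iff subset_eq)
  qed (auto simp: add_ac dest!: subsetD[OF keys_add])
  have "monoid (group_algebra G)"
    by (rule monoidI) (simp_all add: conv_closed conv_assoc conv_one_left conv_one_right)
  then have "ring (group_algebra G)"
    using ab by (intro ringI) (simp_all add: conv_add_left conv_add_right abelian_group.axioms)
  moreover have "Module.module rat_field (group_algebra G)"
  proof (rule moduleI)
    show "cring rat_field" by (rule cring_from_type_algebra)
    show "abelian_group (group_algebra G)" by (rule ab)
    show "a \<odot>\<^bsub>group_algebra G\<^esub> f \<in> carrier (group_algebra G)" if "f \<in> carrier (group_algebra G)" for a f
      using that keys_scale[of a f] by auto
  qed (auto intro!: poly_mapping_eqI simp: lookup_map_scale lookup_add algebra_simps)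
  ultimately show ?thesis
    by (intro rat_algebra.intro rat_algebra_axioms.intro) (simp_all add: scale_conv)
qed

end

lemma family_basis_cong:
  "(\<And>i. i \<in> I \<Longrightarrow> b i = c i) \<Longrightarrow> family_basis V I b \<longleftrightarrow> family_basis V I c"
  by (simp add: family_basis_def cong: inj_on_cong image_cong)

section \<open>Multiplication by \<open>xA W S s (n - 1)\<close> and linear independence\<close>

context coxeter_system_A
begin

lemma xA_eq: "xA W S s j = (\<Sum>w\<in>reps j. Poly_Mapping.single w 1)"
  by (simp add: xA_def x_elem_def reps_def)

lemma keys_xA: "j \<le> n \<Longrightarrow> Poly_Mapping.keys (xA W S s j) \<subseteq> carrier W"
  unfolding xA_eq by (auto simp: in_keys_iff lookup_sum lookup_single when_def mem_reps split: if_splits)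

lemma lookup_xA: "Poly_Mapping.lookup (xA W S s j) w = (if w \<in> reps j then 1 else 0)"
  by (simp add: xA_eq lookup_sum lookup_single when_def)

lemma xA_top: "xA W S s n = Poly_Mapping.single \<one> 1"
  by (simp add: xA_eq reps_top)

text \<open>The case \<open>j = n\<close> of \<open>bij_reps\<close>, where the only left factor is
  the identity.\<close>

lemma xA_pred:
  assumes "1 \<le> n"
  shows "xA W S s (n - 1) = (\<Sum>k=1..Suc n. Poly_Mapping.single (ascending k n) 1)"
proof -
  have "xA W S s (n - 1) = (\<Sum>(w, k) \<in> reps n \<times> {1..Suc n}. Poly_Mapping.single (w \<otimes> ascending k n) 1)"
    unfolding xA_eq case_prod_unfold
    using sum.reindex_bij_betw[OF bij_reps[of n], of "\<lambda>w. Poly_Mapping.single w 1", symmetric] assms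
    by (simp add: case_prod_unfold)
  also have "\<dots> = (\<Sum>w\<in>reps n. \<Sum>k=1..Suc n. Poly_Mapping.single (w \<otimes> ascending k n) 1)"
    by (rule sum.cartesian_product[symmetric])
  finally show ?thesis unfolding reps_top by simp
qed

lemma xA_mult_pred:
  assumes "1 \<le> n"
  shows "xA W S s j \<star> xA W S s (n - 1) =
    (\<Sum>k=1..Suc n. \<Sum>w\<in>reps j. Poly_Mapping.single (w \<otimes> ascending k n) 1)"
  unfolding xA_pred[OF assms] unfolding xA_eq conv_sum_right conv_sum_left by simp

lemma xA_zero_mult_pred:
  assumes "1 \<le> n"
  shows "xA W S s 0 \<star> xA W S s (n - 1) = scale (of_nat (n + 1)) (xA W S s 0)"
proof -
  have "xA W S s 0 \<star> xA W S s (n - 1) = (\<Sum>k=1..Suc n. xA W S s 0)"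
    unfolding xA_mult_pred[OF assms]
  proof (rule sum.cong[OF HOL.refl])
    fix k assume "k \<in> {1..Suc n}"
    then show "(\<Sum>w\<in>reps 0. Poly_Mapping.single (w \<otimes> ascending k n) 1) = xA W S s 0"
      unfolding xA_eq
      using sum.reindex_bij_betw[OF bij_reps_zero[of k], of "\<lambda>w. Poly_Mapping.single w 1"] by simp
  qed
  also have "\<dots> = scale (of_nat (n + 1)) (xA W S s 0)"
    by (rule poly_mapping_eqI) (simp only: lookup_map_scale lookup_sum, simp)
  finally show ?thesis .
qed

lemma xA_mult_pred_step:
  assumes "1 \<le> j" "j \<le> n"
  shows "xA W S s j \<star> xA W S s (n - 1) = xA W S s (j - 1) + scale (of_nat (n - j)) (xA W S s j)"
proof -
  let ?t = "\<lambda>k. \<Sum>w\<in>reps j. Poly_Mapping.single (w \<otimes> ascending k n) (1::rat)"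
  have n: "1 \<le> n" using assms by simp
  have far: "(\<Sum>w\<in>reps i. Poly_Mapping.single (w \<otimes> ascending k n) 1) = xA W S s i"
    if "i + 1 < k" "k \<le> n + 1" for i k
    unfolding xA_eq
    using sum.reindex_bij_betw[OF bij_reps_mult_ascending_far[OF that], of "\<lambda>w. Poly_Mapping.single w 1"] .
  \<comment> \<open>For \<open>k \<le> Suc j\<close>, \<open>ascending k n\<close> is split after
    \<open>s j\<close>: the first factors sweep out \<open>reps (j - 1)\<close> by
    \<open>bij_reps\<close>, and the common second factor permutes that set by
    \<open>far\<close>.\<close>
  have "(\<Sum>k=1..Suc j. ?t k) = (\<Sum>w\<in>reps j. \<Sum>k=1..Suc j. Poly_Mapping.single (w \<otimes> ascending k n) 1)"
    by (rule sum.swap)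
  also have "\<dots> = (\<Sum>w\<in>reps j. \<Sum>k=1..Suc j.
      Poly_Mapping.single ((w \<otimes> ascending k j) \<otimes> ascending (Suc j) n) 1)"
  proof (intro sum.cong HOL.refl)
    fix w k assume "w \<in> reps j" "k \<in> {1..Suc j}"
    then show "Poly_Mapping.single (w \<otimes> ascending k n) (1::rat) =
        Poly_Mapping.single ((w \<otimes> ascending k j) \<otimes> ascending (Suc j) n) 1"
      using ascending_split[of k j n] assms by (auto simp: mem_reps m_assoc)
  qed
  also have "\<dots> = (\<Sum>(w, k) \<in> reps j \<times> {1..Suc j}.
      Poly_Mapping.single ((w \<otimes> ascending k j) \<otimes> ascending (Suc j) n) 1)"
    by (rule sum.cartesian_product)
  also have "\<dots> = (\<Sum>v\<in>reps (j - 1). Poly_Mapping.single (v \<otimes> ascending (Suc j) n) 1)"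
    using sum.reindex_bij_betw[OF bij_reps[OF assms], of "\<lambda>v. Poly_Mapping.single (v \<otimes> ascending (Suc j) n) (1::rat)"]
    by (simp only: case_prod_unfold)
  also have "\<dots> = xA W S s (j - 1)" using far[of "j - 1" "Suc j"] assms by simp
  finally have 1: "(\<Sum>k=1..Suc j. ?t k) = xA W S s (j - 1)" .
  \<comment> \<open>Each of the remaining \<open>n - j\<close> values of \<open>k\<close> permutes
    \<open>reps j\<close>.\<close>
  have "(\<Sum>k=Suc (Suc j)..Suc n. ?t k) = (\<Sum>k=Suc (Suc j)..Suc n. xA W S s j)"
    by (intro sum.cong HOL.refl) (use far in auto)
  also have "\<dots> = scale (of_nat (n - j)) (xA W S s j)"
    by (rule poly_mapping_eqI) (simp only: lookup_map_scale lookup_sum, simp)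
  finally have 2: "(\<Sum>k=Suc (Suc j)..Suc n. ?t k) = scale (of_nat (n - j)) (xA W S s j)" .
  have "{1..Suc n} = {1..Suc j} \<union> {Suc (Suc j)..Suc n}" using assms by auto
  then have "(\<Sum>k=1..Suc n. ?t k) = (\<Sum>k=1..Suc j. ?t k) + (\<Sum>k=Suc (Suc j)..Suc n. ?t k)"
    by (simp only:) (rule sum.union_disjoint, auto)
  then show ?thesis unfolding xA_mult_pred[OF n] 1 2 .
qed

text \<open>The coefficients at the identity and at the generators are the tail sums of
  \<open>a\<close>; consecutive tail sums differ by one coefficient.\<close>

lemma xA_independent:
  assumes "(\<Sum>k\<le>n. scale (a k) (xA W S s (n - k))) = 0" "i \<le> n"
  shows "a i = 0"
proof -
  have lookup: "(\<Sum>k\<le>n. if w \<in> reps (n - k) then a k else 0) = 0" for w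
  proof -
    have "Poly_Mapping.lookup (\<Sum>k\<le>n. scale (a k) (xA W S s (n - k))) w = 0" using assms(1) by simp
    then show ?thesis by (simp add: lookup_sum lookup_map_scale lookup_xA if_distrib cong: if_cong)
  qed
  have T: "(\<Sum>k=i..n. a k) = 0" if "i \<le> n" for i
  proof (cases "i = 0")
    case True
    then show ?thesis using lookup[of \<one>] one_mem_reps by (simp add: atLeast0AtMost)
  next
    case False
    have "(\<Sum>k=i..n. a k) = (\<Sum>k\<le>n. if k \<in> {i..n} then a k else 0)"
      by (subst sum.inter_restrict[symmetric]) (auto intro!: sum.cong)
    \<comment> \<open>The generator is chosen so that \<open>n - k < n - i + 1\<close> amounts to
      \<open>i \<le> k\<close>.\<close>
    also have "\<dots> = (\<Sum>k\<le>n. if s (n - i + 1) \<in> reps (n - k) then a k else 0)"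
      using that False by (intro sum.cong HOL.refl) (auto simp: s_mem_reps_iff)
    finally show ?thesis using lookup by simp
  qed
  have "(\<Sum>k=i..n. a k) = a i + (\<Sum>k=Suc i..n. a k)"
    using assms(2) by (rule sum.atLeast_Suc_atMost)
  moreover have "(\<Sum>k=Suc i..n. a k) = 0" using T[of "Suc i"] by (cases "Suc i \<le> n") auto
  ultimately show ?thesis using T[OF assms(2)] by simp
qed

end

theorem proposition3p4:
  fixes W :: "('w, 'm) monoid_scheme" (structure)
    and S :: "'w set" and s :: "nat \<Rightarrow> 'w" and n :: nat
  assumes "coxeter_system_A W S s n" and "n \<ge> 1"
  shows
    "algebra_isomorphic (E_algebra W S s n)
       (quotient_algebra poly_algebra
         (PIdl\<^bsub>poly_algebra\<^esub> (falling_power (n + 1) - falling_power n))) \<and>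
     family_basis (E_algebra W S s n) {0..n} (\<lambda>j. xA W S s j) \<and>
     family_basis (E_algebra W S s n) {0..n} (\<lambda>j. xA W S s (n - 1) [^]\<^bsub>group_algebra W\<^esub> j) \<and>
     (\<forall>k \<le> n. xA W S s (n - k) =
       (\<Oplus>\<^bsub>group_algebra W\<^esub> m \<in> {0..k}.
         ((-1) ^ (k - m) * rat_of_nat (stirling k m))
           \<odot>\<^bsub>group_algebra W\<^esub> (xA W S s (n - 1) [^]\<^bsub>group_algebra W\<^esub> m))) \<and>
     (\<forall>k \<le> n. xA W S s (n - 1) [^]\<^bsub>group_algebra W\<^esub> k =
       (\<Oplus>\<^bsub>group_algebra W\<^esub> m \<in> {0..k}.
         rat_of_nat (Stirling k m) \<odot>\<^bsub>group_algebra W\<^esub> xA W S s (n - m)))"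
proof -
  interpret coxeter_system_A W S s n by fact
  interpret QW: rat_algebra "group_algebra W" by (rule rat_algebra_group_algebra)
  let ?x = "xA W S s (n - 1)" and ?X = "\<lambda>k. xA W S s (n - k)"
  let ?f = "falling_power (n + 1) - falling_power n"
  have x: "?x \<in> carrier (group_algebra W)" using keys_xA by simp
  have closed: "scale c (?X k) \<in> carrier (group_algebra W)" for c k
    using QW.smult_closed'[of "?X k" c] keys_xA[of "n - k"] by simp
  have falling_step: "QW.poly_at ?x (falling_power (Suc k)) =
      QW.poly_at ?x (falling_power k) \<star> ?x + scale (- of_nat k) (QW.poly_at ?x (falling_power k))" for k
  proof -
    have eq: "falling_power (Suc k) = falling_power k * [:0, 1:] + smult (- of_nat k) (falling_power k)"
      by (simp add: falling_power_Suc)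
    show ?thesis
      unfolding eq QW.poly_at_add[OF x] QW.poly_at_mult[OF x] QW.poly_at_smult[OF x] QW.poly_at_X[OF x]
      by (simp only: group_algebra_simps)
  qed
  have falling: "QW.poly_at ?x (falling_power k) = ?X k" if "k \<le> n" for k
    using that
  proof (induction k)
    case 0
    show ?case using QW.poly_at_1[OF x] by (simp add: xA_top)
  next
    case (Suc k)
    then have "QW.poly_at ?x (falling_power (Suc k)) = ?X k \<star> ?x + scale (- of_nat k) (?X k)"
      unfolding falling_step by simp
    \<comment> \<open>Since \<open>n - (n - k) = k\<close>, the product contributes \<open>k\<close>
      times \<open>?X k\<close>, which the last term cancels.\<close>
    also have "\<dots> = ?X (Suc k) + scale (of_nat k) (?X k) + scale (- of_nat k) (?X k)"
      using xA_mult_pred_step[of "n - k"] Suc.prems by simp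
    also have "\<dots> = ?X (Suc k)"
      by (rule poly_mapping_eqI) (simp add: lookup_add lookup_map_scale)
    finally show ?case .
  qed
  have degree_f: "Polynomial.degree ?f = Suc n"
    using falling_power_degree[of "Suc n"] falling_power_degree[of n]
      degree_add_eq_left[of "- falling_power n" "falling_power (Suc n)"] by simp
  have root: "QW.poly_at ?x ?f = 0"
  proof -
    have "falling_power (Suc n) = ?f + falling_power n" by simp
    then have "QW.poly_at ?x (falling_power (Suc n)) = QW.poly_at ?x ?f + ?X n"
      using QW.poly_at_add[OF x, of ?f "falling_power n"] falling[of n] by simp
    \<comment> \<open>At \<open>k = n\<close> the product is \<open>n + 1\<close> times
      \<open>?X n\<close>, and subtracting \<open>n\<close> times \<open>?X n\<close> leaves
      \<open>?X n\<close> again.\<close>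
    moreover have "QW.poly_at ?x (falling_power (Suc n)) = ?X n"
      unfolding falling_step using falling[of n] xA_zero_mult_pred[OF assms(2)]
      by (auto intro!: poly_mapping_eqI simp: lookup_add lookup_map_scale algebra_simps)
    ultimately show ?thesis by simp
  qed
  have kernel: "QW.poly_at ?x p = \<zero>\<^bsub>group_algebra W\<^esub> \<longleftrightarrow> ?f dvd p" for p
  proof
    assume "?f dvd p"
    then obtain g where p: "p = ?f * g" by (auto simp: dvd_def)
    show "QW.poly_at ?x p = \<zero>\<^bsub>group_algebra W\<^esub>"
      unfolding p QW.poly_at_mult[OF x] root by simp
  next
    assume p: "QW.poly_at ?x p = \<zero>\<^bsub>group_algebra W\<^esub>"
    \<comment> \<open>The remainder has degree at most \<open>n\<close>, so its value is a
      combination of the \<open>?X k\<close> with \<open>k \<le> n\<close>; independence forces it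
      to be zero.\<close>
    have "p = ?f * (p div ?f) + p mod ?f" by simp
    then have "QW.poly_at ?x p = QW.poly_at ?x ?f \<star> QW.poly_at ?x (p div ?f) + QW.poly_at ?x (p mod ?f)"
      using QW.poly_at_add[OF x] QW.poly_at_mult[OF x] by (metis group_algebra_simps(4))
    then have r: "QW.poly_at ?x (p mod ?f) = 0" using p root by simp
    have "?f \<noteq> 0" using degree_f by auto
    then have "Polynomial.degree (p mod ?f) \<le> n"
      using degree_mod_less[of ?f p] degree_f by auto
    then obtain a where a: "p mod ?f = (\<Sum>k\<le>n. smult (a k) (falling_power k))"
      using poly_sum_degree_basis[of n falling_power "p mod ?f"] falling_power_degree by blast
    have "QW.poly_at ?x (p mod ?f) = (\<Oplus>\<^bsub>group_algebra W\<^esub> k \<in> {..n}. scale (a k) (?X k))"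
      unfolding a QW.poly_at_sum[OF x finite_atMost] by (intro QW.finsum_cong') (use closed falling in auto)
    also have "\<dots> = (\<Sum>k\<le>n. scale (a k) (?X k))"
      using closed by (intro finsum_group_algebra QW.M.abelian_monoid_axioms) auto
    finally have "QW.poly_at ?x (p mod ?f) = (\<Sum>k\<le>n. scale (a k) (?X k))" .
    then have "a k = 0" if "k \<le> n" for k using xA_independent[of a k] r that by simp
    then have "p mod ?f = 0" unfolding a by simp
    then show "?f dvd p" by auto
  qed
  have E: "E_algebra W S s n = adjoin (group_algebra W) ?x" by (simp add: E_algebra_def)
  have "family_basis (E_algebra W S s n) {0..n} (\<lambda>k. QW.poly_at ?x (falling_power k))"
    unfolding E by (rule QW.family_basis_adjoin[OF x degree_f kernel falling_power_degree])
  then have "family_basis (E_algebra W S s n) {0..n} (\<lambda>j. QW.poly_at ?x (falling_power (n - j)))"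
    by (rule family_basis_reindex) (rule bij_betw_byWitness[where f' = "\<lambda>j. n - j"], auto)
  then have basis_x: "family_basis (E_algebra W S s n) {0..n} (\<lambda>j. xA W S s j)"
    by (rule family_basis_cong[THEN iffD1, rotated]) (simp add: falling del: One_nat_def)
  have basis_power: "family_basis (E_algebra W S s n) {0..n} (\<lambda>j. ?x [^]\<^bsub>group_algebra W\<^esub> j)"
    unfolding E QW.poly_at_monom[OF x, symmetric]
    by (rule QW.family_basis_adjoin[OF x degree_f kernel]) (simp add: degree_monom_eq)
  \<comment> \<open>Both base change formulas are the images of polynomial identities under
    evaluation at \<open>?x\<close>.\<close>
  have 1: "?X k = (\<Oplus>\<^bsub>group_algebra W\<^esub> m \<in> {0..k}.
        ((-1) ^ (k - m) * rat_of_nat (stirling k m)) \<odot>\<^bsub>group_algebra W\<^esub> (?x [^]\<^bsub>group_algebra W\<^esub> m))"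
    if "k \<le> n" for k
    unfolding falling[OF that, symmetric] QW.poly_at_monom[OF x, symmetric] atLeast0AtMost
      QW.poly_at_sum[OF x finite_atMost, symmetric]
    by (rule arg_cong[OF falling_power_eq_sum_monom])
  have 2: "?x [^]\<^bsub>group_algebra W\<^esub> k = (\<Oplus>\<^bsub>group_algebra W\<^esub> m \<in> {0..k}.
        rat_of_nat (Stirling k m) \<odot>\<^bsub>group_algebra W\<^esub> ?X m)"
    if "k \<le> n" for k
  proof -
    have "?x [^]\<^bsub>group_algebra W\<^esub> k = (\<Oplus>\<^bsub>group_algebra W\<^esub> m \<in> {..k}.
        rat_of_nat (Stirling k m) \<odot>\<^bsub>group_algebra W\<^esub> QW.poly_at ?x (falling_power m))"
      unfolding QW.poly_at_monom[OF x, symmetric] QW.poly_at_sum[OF x finite_atMost, symmetric]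
      by (rule arg_cong[OF monom_eq_sum_falling_power])
    also have "\<dots> = (\<Oplus>\<^bsub>group_algebra W\<^esub> m \<in> {0..k}.
        rat_of_nat (Stirling k m) \<odot>\<^bsub>group_algebra W\<^esub> ?X m)"
      using that closed by (intro QW.finsum_cong') (auto simp: falling simp del: One_nat_def)
    finally show ?thesis .
  qed
  show ?thesis
    using QW.adjoin_isomorphic[OF x degree_f kernel] basis_x basis_power 1 2 unfolding E by blast
qed

end
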